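(* Suppose the semidefinite system $$\langle M_i,X\rangle=d_i\ (i=1,\dots,m),\qquad X\in\mathcal S^n_+$$ with $M_i\in\mathcal S^n$, $d_i\in\mathbb R$, is in rank revealing (RR) form. Then its singularity degree is $m$ if and only if the following hold: 1. All of the $m$ equations certify the maximum rank of a feasible solution in it. In particular, $d=0$. 2. All the critical blocks in $M_2,\dots,M_m$ are nonzero.
   Context: Notation. $\mathcal S^n$ is the space of $n\times n$ real symmetric matrices, $\mathcal S^n_+$ the cone of positive semidefinite ones, $\langle S,T\rangle=\mathrm{trace}(ST)$, $[n]=\{1,\dots,n\}$. For a matrix $M$ and $R,S\subseteq[n]$, $M(R,S)$ is the submatrix with rows $R$ and columns $S$, and $M(R)=M(R,R)$. Regular facial reduction sequence. A sequence $(Y_1,\dots,Y_t)$ in $\mathcal S^n$ is a regular facial reduction sequence for $\mathcal S^n_+$ with structure $(P_1,\dots,P_t)$ if $P_1,\dots,P_t\subseteq[n]$ are pairwise disjoint (possibly empty) and for every $i$: $Y_i(P_i)$ is diagonal positive definite, and all entries of $Y_i([n]\setminus(P_1\cup\dots\cup P_{i-1}))$ outside the block $Y_i(P_i)$ are zero (entries in rows or columns indexed by $P_1\cup\dots\cup P_{i-1}$ are arbitrary). The sequence reduces $\mathcal S^n_+$ to $\mathcal S^n_+\cap Y_1^\perp\cap\dots\cap Y_t^\perp$, where $Y^\perp=\{X\in\mathcal S^n:\langle Y,X\rangle=0\}$. Critical block. For such a sequence, set $P_{t+1}=[n]\setminus(P_1\cup\dots\cup P_t)$. The critical block in $Y_i$,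 $i=2,\dots,t$, is the submatrix $Y_i(P_{i-1},\,P_{i+1}\cup\dots\cup P_{t+1})$. In item 2 of the claim, the critical blocks are those of the regular facial reduction sequence $(M_1,\dots,M_m)$. RR form. The system $\langle M_i,X\rangle=d_i$ $(i=1,\dots,m)$, $X\in\mathcal S^n_+$ is in rank revealing (RR) form if for some $k\in\{0,\dots,m\}$ and $r\in\{0,\dots,n\}$: (i) $(M_1,\dots,M_k)$ is a regular facial reduction sequence which reduces $\mathcal S^n_+$ to the set of matrices in $\mathcal S^n_+$ in which only the lower right $r\times r$ block may be nonzero; (ii) $d_1=\dots=d_k=0$; (iii) there is a feasible $X$ of the form $\begin{pmatrix}0&0\\0&\Lambda\end{pmatrix}$ with $\Lambda$ positive definite of order $r$. One then says that the first $k$ equations certify the maximum rank of a feasible solution; "all of the $m$ equations certify the maximum rank" means that this holds with $k=m$. Reformulation. A reformulation of the system is any system obtained from it by applying some of the following operations, in any order: (a) rotating by an invertible matrix $T$, i.e. replacing every $M_i$ by $T^\top M_iT$; (b) exchanging two equations; (c) for some $i$ and $y\in\mathbb R^m$ with $y_i\ne0$, replacing $\langle M_i,X\rangle=d_i$ by $\langle\sum_t y_tM_t,X\rangle=\langle d,y\rangle$. Singularity degree. The singularity degree of (the feasible set of) a semidefinite system is the smallest $k$ such that the system can be reformulated into an RR form in which the first $k$ equations certify the maximum rank of a feasible solution.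
   Formalization: The "if" direction additionally assumes the last block P_m of the regular facial reduction sequence (M_1,…,M_m) is nonempty; otherwise it fails, e.g. m=1, M_1=0, d_1=0 has singularity degree 0. The "only if" direction needs no extra assumption. *)

theory Defs
  imports "HOL-Analysis.Analysis"
begin

text \<open>
  The index set \<open>[n]\<close> is an arbitrary nonempty finite type \<open>'n\<close>, linearly ordered where
  ``lower right'' has to make sense. Sequences of matrices and equations are functions on
  \<open>nat\<close> of which only the values at \<open>1, \<dots>, m\<close> matter.
\<close>

subsection \<open>Symmetric matrices\<close>

definition sym_mats :: "(real^'n^'n) set" where
  "sym_mats = {S. transpose S = S}"

definition psd_cone :: "(real^'n^'n) set" where
  "psd_cone = {S \<in> sym_mats. \<forall>v. 0 \<le> v \<bullet> (S *v v)}"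

definition mat_inner :: "real^'n^'n \<Rightarrow> real^'n^'n \<Rightarrow> real" where
  "mat_inner S T = trace (S ** T)"

definition mat_perp :: "real^'n^'n \<Rightarrow> (real^'n^'n) set" where
  "mat_perp Y = {X \<in> sym_mats. mat_inner Y X = 0}"

text \<open>
  Positive definiteness of the principal submatrix \<open>S(R)\<close>: a vector indexed by \<open>R\<close> is
  represented by its extension by zero to \<open>[n]\<close>. For empty \<open>R\<close> this holds vacuously.
\<close>

definition pos_def_on :: "'n set \<Rightarrow> real^'n^'n \<Rightarrow> bool" where
  "pos_def_on R S \<longleftrightarrow>
     (\<forall>a\<in>R. \<forall>b\<in>R. S $ a $ b = S $ b $ a) \<and>
     (\<forall>v. v \<noteq> 0 \<longrightarrow> (\<forall>a. a \<notin> R \<longrightarrow> v $ a = 0) \<longrightarrow> 0 < v \<bullet> (S *v v))"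

text \<open>\<open>S(R,C) = 0\<close>; a block without rows or columns counts as zero.\<close>

definition block_zero :: "real^'n^'n \<Rightarrow> 'n set \<Rightarrow> 'n set \<Rightarrow> bool" where
  "block_zero S R C \<longleftrightarrow> (\<forall>a\<in>R. \<forall>b\<in>C. S $ a $ b = 0)"


subsection \<open>Regular facial reduction sequences and critical blocks\<close>

definition regular_fr_seq ::
    "nat \<Rightarrow> (nat \<Rightarrow> real^'n^'n) \<Rightarrow> (nat \<Rightarrow> 'n set) \<Rightarrow> bool" where
  "regular_fr_seq t Y P \<longleftrightarrow>
     (\<forall>i\<in>{1..t}. Y i \<in> sym_mats) \<and>
     disjoint_family_on P {1..t} \<and>
     (\<forall>i\<in>{1..t}.
        (\<forall>a\<in>P i. \<forall>b\<in>P i. a \<noteq> b \<longrightarrow> Y i $ a $ b = 0) \<and>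
        pos_def_on (P i) (Y i) \<and>
        (\<forall>a b. a \<notin> (\<Union>j\<in>{1..<i}. P j) \<longrightarrow> b \<notin> (\<Union>j\<in>{1..<i}. P j) \<longrightarrow>
               \<not> (a \<in> P i \<and> b \<in> P i) \<longrightarrow> Y i $ a $ b = 0))"

definition reduced_cone :: "nat \<Rightarrow> (nat \<Rightarrow> real^'n^'n) \<Rightarrow> (real^'n^'n) set" where
  "reduced_cone t Y = psd_cone \<inter> (\<Inter>i\<in>{1..t}. mat_perp (Y i))"

text \<open>The structure \<open>P\<^sub>1, \<dots>, P\<^sub>t\<close> extended by \<open>P\<^bsub>t+1\<^esub> = [n] - (P\<^sub>1 \<union> \<dots> \<union> P\<^sub>t)\<close>.\<close>

definition ext_structure :: "nat \<Rightarrow> (nat \<Rightarrow> 'n set) \<Rightarrow> nat \<Rightarrow> 'n set" where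
  "ext_structure t P i = (if i = t + 1 then UNIV - (\<Union>j\<in>{1..t}. P j) else P i)"

text \<open>
  The structure is determined by the sequence (\<open>regular_fr_seq_unique\<close> below), so the existential
  quantifier only names it.
\<close>

definition critical_blocks_nonzero :: "nat \<Rightarrow> (nat \<Rightarrow> real^'n^'n) \<Rightarrow> bool" where
  "critical_blocks_nonzero t Y \<longleftrightarrow>
     (\<exists>P. regular_fr_seq t Y P \<and>
          (\<forall>i\<in>{2..t}. \<not> block_zero (Y i) (P (i - 1)) (\<Union>j\<in>{i+1..t+1}. ext_structure t P j)))"

lemma pos_def_on_diag:
  assumes "pos_def_on R S" "a \<in> R"
  shows "0 < S $ a $ a"
proof -
  have "axis a (1::real) \<noteq> 0"
    by (simp add: axis_eq_0_iff)
  moreover have "\<forall>b. b \<notin> R \<longrightarrow> axis a (1::real) $ b = 0"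
    using assms(2) by (auto simp: axis_def)
  ultimately have "0 < axis a 1 \<bullet> (S *v axis a 1)"
    using assms(1) unfolding pos_def_on_def by blast
  then show ?thesis
    by (simp add: inner_axis' matrix_vector_mult_basis column_def)
qed

lemma regular_fr_seq_unique:
  assumes P: "regular_fr_seq t Y P" and Q: "regular_fr_seq t Y Q"
    and i: "i \<in> {1..t}"
  shows "P i = Q i"
  using i
proof (induction i rule: less_induct)
  case (less i)
  have char: "R i = {a. a \<notin> (\<Union>j\<in>{1..<i}. R j) \<and> Y i $ a $ a \<noteq> 0}"
    if R: "regular_fr_seq t Y R" for R
  proof -
    have "a \<notin> R j" if "a \<in> R i" "j \<in> {1..<i}" for a j
      using R less.prems that unfolding regular_fr_seq_def disjoint_family_on_def
      by (fastforce simp: disjoint_iff)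
    moreover have "Y i $ a $ a \<noteq> 0" if "a \<in> R i" for a
      using R less.prems that pos_def_on_diag[of "R i" "Y i" a]
      unfolding regular_fr_seq_def by fastforce
    moreover have "a \<in> R i" if "a \<notin> (\<Union>j\<in>{1..<i}. R j)" "Y i $ a $ a \<noteq> 0" for a
      using R less.prems that unfolding regular_fr_seq_def by blast
    ultimately show ?thesis by blast
  qed
  have "(\<Union>j\<in>{1..<i}. P j) = (\<Union>j\<in>{1..<i}. Q j)"
    using less by (intro SUP_cong) auto
  then show ?case
    using char[OF P] char[OF Q] by simp
qed


subsection \<open>Rank revealing form\<close>

text \<open>The last \<open>r\<close> indices: those with at most \<open>r\<close> indices greater or equal.\<close>

definition last_indices :: "nat \<Rightarrow> 'n::{finite,linorder} set" where
  "last_indices r = {a. card {a..} \<le> r}"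

definition supported_on :: "'n set \<Rightarrow> (real^'n^'n) set" where
  "supported_on R = {X. \<forall>a b. X $ a $ b \<noteq> 0 \<longrightarrow> a \<in> R \<and> b \<in> R}"

definition feasible :: "nat \<Rightarrow> (nat \<Rightarrow> real^'n^'n) \<Rightarrow> (nat \<Rightarrow> real) \<Rightarrow> real^'n^'n \<Rightarrow> bool" where
  "feasible m M d X \<longleftrightarrow> X \<in> psd_cone \<and> (\<forall>i\<in>{1..m}. mat_inner (M i) X = d i)"

text \<open>
  The system with \<open>m\<close> equations is in RR form, and its first \<open>k\<close> equations certify the maximum
  rank of a feasible solution.
\<close>

definition certify_max_rank ::
    "nat \<Rightarrow> (nat \<Rightarrow> real^'n::{finite,linorder}^'n::{finite,linorder}) \<Rightarrow> (nat \<Rightarrow> real) \<Rightarrow> nat \<Rightarrow> bool" where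
  "certify_max_rank m M d k \<longleftrightarrow>
     k \<le> m \<and>
     (\<exists>r\<le>CARD('n).
        (\<exists>P. regular_fr_seq k M P) \<and>
        reduced_cone k M = psd_cone \<inter> supported_on (last_indices r) \<and>
        (\<forall>i\<in>{1..k}. d i = 0) \<and>
        (\<exists>X. feasible m M d X \<and> X \<in> supported_on (last_indices r) \<and>
             pos_def_on (last_indices r) X))"

definition rr_form ::
    "nat \<Rightarrow> (nat \<Rightarrow> real^'n::{finite,linorder}^'n::{finite,linorder}) \<Rightarrow> (nat \<Rightarrow> real) \<Rightarrow> bool" where
  "rr_form m M d \<longleftrightarrow> (\<exists>k. certify_max_rank m M d k)"


subsection \<open>Reformulations and singularity degree\<close>

inductive reformulation ::
    "nat \<Rightarrow> (nat \<Rightarrow> real^'n^'n) \<Rightarrow> (nat \<Rightarrow> real) \<Rightarrow>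
       (nat \<Rightarrow> real^'n^'n) \<Rightarrow> (nat \<Rightarrow> real) \<Rightarrow> bool"
  for m M d where
  refl: "reformulation m M d M d"
| rotate: "reformulation m M d M' d' \<Longrightarrow> invertible T \<Longrightarrow>
     reformulation m M d (\<lambda>i. transpose T ** M' i ** T) d'"
| exchange: "reformulation m M d M' d' \<Longrightarrow> i \<in> {1..m} \<Longrightarrow> j \<in> {1..m} \<Longrightarrow>
     reformulation m M d (M'(i := M' j, j := M' i)) (d'(i := d' j, j := d' i))"
| combine: "reformulation m M d M' d' \<Longrightarrow> i \<in> {1..m} \<Longrightarrow> y i \<noteq> 0 \<Longrightarrow>
     reformulation m M d (M'(i := \<Sum>t=1..m. y t *\<^sub>R M' t)) (d'(i := \<Sum>t=1..m. y t * d' t))"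

text \<open>
  The minimum is over a nonempty set in particular when the system itself is in RR form.
\<close>

definition singularity_degree ::
    "nat \<Rightarrow> (nat \<Rightarrow> real^'n::{finite,linorder}^'n::{finite,linorder}) \<Rightarrow> (nat \<Rightarrow> real) \<Rightarrow> nat" where
  "singularity_degree m M d =
     (LEAST k. \<exists>M' d'. reformulation m M d M' d' \<and> certify_max_rank m M' d' k)"

text \<open>
  The blocks of a regular facial reduction sequence may be empty. If the last one is, the last
  matrix does not reduce the cone any further, so \<open>t\<close> cannot be a singularity degree, although
  nonzero critical blocks only force \<open>P\<^sub>1, \<dots>, P\<^bsub>t-1\<^esub>\<close> to be nonempty.
  For example \<open>m = 1\<close>, \<open>M\<^sub>1 = 0\<close>, \<open>d\<^sub>1 = 0\<close> has singularity degree \<open>0\<close>, all equations (namely the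
  first) certify the maximum rank, and there is no critical block.
  The predicate below excludes this; it is vacuous if \<open>(Y\<^sub>1, \<dots>, Y\<^sub>t)\<close> is not regular or \<open>t = 0\<close>.
\<close>

definition last_block_nonempty :: "nat \<Rightarrow> (nat \<Rightarrow> real^'n^'n) \<Rightarrow> bool" where
  "last_block_nonempty t Y \<longleftrightarrow> (\<forall>P. regular_fr_seq t Y P \<longrightarrow> 1 \<le> t \<longrightarrow> P t \<noteq> {})"

end

theory Submission
  imports Defs
begin

text \<open>
  A zero critical block allows two consecutive matrices of the sequence to be merged into one, which
  yields a shorter certificate. Conversely, if all critical blocks are nonzero, then any combination
  of the \<open>M\<^sub>i\<close> that is psd on the indices outside \<open>P\<^sub>1, \<dots>, P\<^bsub>j-1\<^esub>\<close> involves only \<open>M\<^sub>1, \<dots>, M\<^sub>j\<close>. Hence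
  no reformulation reduces the cone in \<open>j\<close> steps by more than \<open>M\<^sub>1, \<dots>, M\<^sub>j\<close> do.
\<close>

subsection \<open>Quadratic forms and congruences\<close>

text \<open>The rotation \<open>T\<close> of a reformulation need not respect the index blocks, so
  two block structures cannot be compared as index sets. The lower bound compares supports of
  vectors instead: if \<open>T *v u\<close> vanishes on the first \<open>j\<close> blocks of the
  original sequence, then \<open>u\<close> vanishes on the first \<open>j\<close> blocks of the
  reformulated one. If \<open>k < m\<close> steps sufficed, an axis vector at an index of
  \<open>P m\<close> would give such a \<open>u\<close>, although every feasible matrix, carried
  back to the original coordinates, is zero at that index; the positive definite block of the
  maximum rank solution rules this out. In the merging step the part of the second matrix between
  the two merged blocks may be nonzero even if the critical block is zero. Hence the large constant,
  and hence the congruence that restores diagonality. The congruence is the identity off the merged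
  indices. Earlier matrices vanish there on what is unreduced, later ones are constrained only
  elsewhere, and the solution is supported elsewhere, so the rest of the certificate
  survives.\<close>

lemma inner_matrix_vector:
  fixes S :: "real^'n^'n"
  shows "v \<bullet> (S *v w) = (\<Sum>a\<in>UNIV. \<Sum>b\<in>UNIV. S $ a $ b * v $ a * w $ b)"
  by (simp add: inner_vec_def matrix_vector_mult_def sum_distrib_left mult_ac)

lemma mat_inner_sum:
  fixes S X :: "real^'n^'n"
  shows "mat_inner S X = (\<Sum>a\<in>UNIV. \<Sum>b\<in>UNIV. S $ a $ b * X $ b $ a)"
  by (simp add: mat_inner_def trace_def matrix_matrix_mult_def)

lemma mat_inner_sum_left: "mat_inner (\<Sum>t\<in>A. S t) X = (\<Sum>t\<in>A. mat_inner (S t) X)"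
  by (induction A rule: infinite_finite_induct)
    (simp_all add: mat_inner_sum distrib_right sum.distrib)

lemma mat_inner_scaleR_left: "mat_inner (c *\<^sub>R S) X = c * mat_inner S X"
  by (simp add: mat_inner_sum sum_distrib_left mult.assoc)

text \<open>By cyclicity of the trace, a solution \<open>X\<close> of the rotated data corresponds
  to \<open>T ** X ** transpose T\<close> for the original data.\<close>

lemma mat_inner_congruence:
  fixes S T X :: "real^'n^'n"
  shows "mat_inner (transpose T ** S ** T) X = mat_inner S (T ** X ** transpose T)"
  using trace_mul_sym[of "transpose T" "S ** T ** X"] by (simp add: mat_inner_def matrix_mul_assoc)

lemma inner_congruence:
  fixes S T :: "real^'n^'n"
  shows "v \<bullet> ((transpose T ** S ** T) *v w) = (T *v v) \<bullet> (S *v (T *v w))"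
  using dot_lmul_matrix[of v "transpose T" "S *v (T *v w)"]
  by (simp add: matrix_vector_mul_assoc matrix_mul_assoc)

lemma congruence_nth:
  fixes S T :: "real^'n^'n"
  shows "(transpose T ** S ** T) $ a $ b = (\<Sum>c\<in>UNIV. \<Sum>e\<in>UNIV. S $ c $ e * T $ c $ a * T $ e $ b)"
proof -
  have "(transpose T ** S ** T) $ a $ b = axis a 1 \<bullet> ((transpose T ** S ** T) *v axis b 1)"
    by (simp add: inner_axis' matrix_vector_mult_basis column_def)
  also have "\<dots> = column a T \<bullet> (S *v column b T)"
    by (simp only: inner_congruence matrix_vector_mult_basis[of T])
  finally show ?thesis
    by (simp add: inner_matrix_vector column_def)
qed

lemma sym_mats_nth:
  fixes S :: "real^'n^'n"
  assumes "S \<in> sym_mats"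
  shows "S $ a $ b = S $ b $ a"
proof -
  have "transpose S $ a $ b = S $ b $ a" by (simp add: transpose_def)
  then show ?thesis using assms by (simp add: sym_mats_def)
qed

lemma sym_matsI: "(\<And>a b. S $ a $ b = S $ b $ a) \<Longrightarrow> S \<in> sym_mats"
  by (simp add: sym_mats_def transpose_def vec_eq_iff)

lemma sym_mats_sum: "(\<And>t. t \<in> A \<Longrightarrow> S t \<in> sym_mats) \<Longrightarrow> (\<Sum>t\<in>A. S t) \<in> sym_mats"
  by (rule sym_matsI) (auto intro!: sum.cong intro: sym_mats_nth)

lemma sym_mats_scaleR: "S \<in> sym_mats \<Longrightarrow> c *\<^sub>R S \<in> sym_mats"
  by (rule sym_matsI) (auto intro: sym_mats_nth)

lemma sym_mats_congruence: "S \<in> sym_mats \<Longrightarrow> transpose T ** S ** T \<in> sym_mats"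
  by (simp add: sym_mats_def matrix_transpose_mul matrix_mul_assoc)

text \<open>Along \<open>x *\<^sub>R axis a 1 + axis b 1\<close> a zero diagonal entry at
  \<open>a\<close> makes the form affine in \<open>x\<close>, so a nonzero entry at
  \<open>(a, b)\<close> would make it negative somewhere. The restriction to \<open>E\<close> serves
  combinations that are semidefinite only on the unreduced indices.\<close>

lemma psd_on_row_zero:
  fixes S :: "real^'n^'n"
  assumes sym: "S \<in> sym_mats"
    and psd: "\<And>v. (\<forall>c. c \<notin> E \<longrightarrow> v $ c = 0) \<Longrightarrow> 0 \<le> v \<bullet> (S *v v)"
    and ab: "a \<in> E" "b \<in> E" and zero: "S $ a $ a = 0"
  shows "S $ a $ b = 0"
proof (rule ccontr)
  assume nz: "S $ a $ b \<noteq> 0"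
  \<comment> \<open>Solves \<open>2 * x * S $ a $ b + S $ b $ b = -1\<close>.\<close>
  define x where "x = - (S $ b $ b + 1) / (2 * S $ a $ b)"
  define v :: "real^'n" where "v = x *\<^sub>R axis a 1 + axis b 1"
  have "v \<bullet> (S *v v) = x * x * S $ a $ a + x * S $ a $ b + x * S $ b $ a + S $ b $ b"
    unfolding v_def
    by (simp add: matrix_vector_right_distrib inner_add_left inner_add_right matrix_vector_mult_scaleR
        inner_axis' matrix_vector_mult_basis column_def algebra_simps)
  also have "\<dots> = -1"
    using nz sym_mats_nth[OF sym, of b a] zero by (simp add: x_def field_simps)
  finally have "v \<bullet> (S *v v) = -1" .
  moreover have "\<forall>c. c \<notin> E \<longrightarrow> v $ c = 0"
    using ab by (auto simp: v_def axis_def)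
  ultimately show False using psd[of v] by simp
qed

lemma psd_cone_row_zero:
  assumes "X \<in> psd_cone" "X $ a $ a = 0"
  shows "X $ a $ b = 0"
  by (rule psd_on_row_zero[where E = UNIV and a = a]) (use assms in \<open>auto simp: psd_cone_def\<close>)

lemma psd_cone_diag_nonneg:
  assumes "X \<in> psd_cone"
  shows "0 \<le> X $ a $ a"
proof -
  have "0 \<le> axis a 1 \<bullet> (X *v axis a 1)" using assms by (simp add: psd_cone_def)
  then show ?thesis by (simp add: inner_axis' matrix_vector_mult_basis column_def)
qed

lemma psd_cone_congruence:
  fixes X T :: "real^'n^'n"
  assumes "X \<in> psd_cone"
  shows "T ** X ** transpose T \<in> psd_cone"
proof -
  have "transpose (transpose T) ** X ** transpose T \<in> psd_cone"
    using assms unfolding psd_cone_def by (auto intro: sym_mats_congruence simp only: inner_congruence)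
  then show ?thesis by simp
qed

text \<open>\<open>axis a (axis a 1)\<close> is the matrix unit at \<open>(a, a)\<close>. It is the
  test matrix by which a face of the cone reveals its index set.\<close>

lemma axis_outer_psd:
  fixes R :: "'n::finite set"
  assumes "a \<in> R"
  shows "axis a (axis a 1) \<in> psd_cone \<inter> supported_on R"
proof -
  have "v \<bullet> (axis a (axis a 1) *v v) = v $ a * v $ a" for v :: "real^'n"
  proof -
    have "v \<bullet> (axis a (axis a 1) *v v) =
        (\<Sum>c\<in>UNIV. \<Sum>b\<in>UNIV. if b = a then (if c = a then v $ a * v $ a else 0) else 0)"
      unfolding inner_matrix_vector by (intro sum.cong[OF HOL.refl]) (simp add: axis_def)
    then show ?thesis by simp
  qed
  then show ?thesis
    using assms by (auto simp: psd_cone_def supported_on_def axis_def intro!: sym_matsI split: if_splits)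
qed

lemma pos_def_on_diagonal:
  fixes S :: "real^'n^'n"
  assumes off: "\<And>a b. a \<in> R \<Longrightarrow> b \<in> R \<Longrightarrow> a \<noteq> b \<Longrightarrow> S $ a $ b = 0"
    and diag: "\<And>a. a \<in> R \<Longrightarrow> 0 < S $ a $ a"
  shows "pos_def_on R S"
proof -
  have "0 < v \<bullet> (S *v v)" if "v \<noteq> 0" and v: "\<forall>a. a \<notin> R \<longrightarrow> v $ a = 0" for v
  proof -
    have "v \<bullet> (S *v v) = (\<Sum>a\<in>UNIV. \<Sum>b\<in>UNIV. if b = a then S $ a $ a * (v $ a)\<^sup>2 else 0)"
      unfolding inner_matrix_vector
      by (intro sum.cong[OF HOL.refl]) (use off v in \<open>auto simp: power2_eq_square\<close>)
    also have "\<dots> = (\<Sum>a\<in>UNIV. S $ a $ a * (v $ a)\<^sup>2)" by simp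
    also have "\<dots> > 0"
    proof -
      obtain a where a: "v $ a \<noteq> 0" using \<open>v \<noteq> 0\<close> by (auto simp: vec_eq_iff)
      then have "a \<in> R" using v by blast
      have "0 \<le> S $ b $ b * (v $ b)\<^sup>2" for b
        using diag[of b] v by (cases "b \<in> R") auto
      moreover have "0 < S $ a $ a * (v $ a)\<^sup>2" using diag[OF \<open>a \<in> R\<close>] a by simp
      ultimately show ?thesis by (intro sum_pos2[of _ a]) auto
    qed
    finally show ?thesis .
  qed
  moreover have "S $ a $ b = S $ b $ a" if "a \<in> R" "b \<in> R" for a b
    using off that by (cases "a = b") auto
  ultimately show ?thesis unfolding pos_def_on_def by blast
qed

text \<open>A Finsler-type lemma. On the unit vectors supported in \<open>R\<close> where
  \<open>B\<close> is nonpositive, \<open>A\<close> is strictly positive; this set is compact, so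
  one factor \<open>c\<close> outweighs \<open>B\<close> on all of it. Elsewhere \<open>B\<close> is
  already positive and \<open>A\<close> is nonnegative.\<close>

lemma pos_def_on_large_combination:
  fixes A B :: "real^'n^'n"
  assumes sym: "A \<in> sym_mats" "B \<in> sym_mats"
    and A: "\<And>v. (\<forall>a. a \<notin> R \<longrightarrow> v $ a = 0) \<Longrightarrow> 0 \<le> v \<bullet> (A *v v)"
    and B: "\<And>v. v \<noteq> 0 \<Longrightarrow> (\<forall>a. a \<notin> R \<longrightarrow> v $ a = 0) \<Longrightarrow> v \<bullet> (A *v v) = 0 \<Longrightarrow> 0 < v \<bullet> (B *v v)"
  obtains c where "c > 0" "pos_def_on R (c *\<^sub>R A + B)"
proof -
  define W where "W = {v :: real^'n. \<forall>a. a \<notin> R \<longrightarrow> v $ a = 0}"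
  define K where "K = sphere 0 1 \<inter> W \<inter> {v. v \<bullet> (B *v v) \<le> 0}"
  have cont: "continuous_on U (\<lambda>v::real^'n. v \<bullet> (S *v v))" for S :: "real^'n^'n" and U
    by (intro continuous_intros linear_continuous_on linear_linear[THEN iffD2] matrix_vector_mul_linear)
  have "closed W"
    unfolding W_def by (intro closed_Collect_all closed_Collect_imp closed_Collect_eq open_Collect_const continuous_intros)
  moreover have "closed {v :: real^'n. v \<bullet> (B *v v) \<le> 0}"
    by (intro closed_Collect_le cont continuous_on_const)
  ultimately have K: "compact K"
    unfolding K_def by (intro compact_Int_closed compact_sphere)
  have "\<exists>c>0. \<forall>v\<in>K. 0 < c * (v \<bullet> (A *v v)) + v \<bullet> (B *v v)"
  proof (cases "K = {}")
    case False
    obtain x where x: "x \<in> K" "\<And>v. v \<in> K \<Longrightarrow> x \<bullet> (A *v x) \<le> v \<bullet> (A *v v)"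
      using continuous_attains_inf[OF K False cont] by metis
    obtain y where y: "y \<in> K" "\<And>v. v \<in> K \<Longrightarrow> y \<bullet> (B *v y) \<le> v \<bullet> (B *v v)"
      using continuous_attains_inf[OF K False cont] by metis
    have xA: "0 < x \<bullet> (A *v x)"
    proof -
      have "x \<noteq> 0" "\<forall>a. a \<notin> R \<longrightarrow> x $ a = 0" "x \<bullet> (B *v x) \<le> 0"
        using x(1) by (auto simp: K_def W_def)
      then show ?thesis using A[of x] B[of x] by fastforce
    qed
    have yB: "y \<bullet> (B *v y) \<le> 0" using y(1) by (simp add: K_def)
    \<comment> \<open>\<open>x\<close> and \<open>y\<close> minimize the two forms over
      \<open>K\<close>, so this value makes the combined form at least 1 on
      \<open>K\<close>.\<close>
    define c where "c = (1 - y \<bullet> (B *v y)) / (x \<bullet> (A *v x))"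
    have "0 < c" using xA yB by (simp add: c_def)
    moreover have "0 < c * (v \<bullet> (A *v v)) + v \<bullet> (B *v v)" if "v \<in> K" for v
    proof -
      have "c * (x \<bullet> (A *v x)) \<le> c * (v \<bullet> (A *v v))"
        using x(2)[OF that] \<open>0 < c\<close> by (intro mult_left_mono) auto
      moreover have "c * (x \<bullet> (A *v x)) = 1 - y \<bullet> (B *v y)" using xA by (simp add: c_def)
      ultimately show ?thesis using y(2)[OF that] by linarith
    qed
    ultimately show ?thesis by blast
  qed (auto intro: exI[of _ 1])
  then obtain c where c: "c > 0" "\<And>v. v \<in> K \<Longrightarrow> 0 < c * (v \<bullet> (A *v v)) + v \<bullet> (B *v v)" by blast
  have "0 < v \<bullet> ((c *\<^sub>R A + B) *v v)" if "v \<noteq> 0" and v: "\<forall>a. a \<notin> R \<longrightarrow> v $ a = 0" for v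
  proof -
    define u where "u = v /\<^sub>R norm v"
    have u: "norm u = 1" "\<forall>a. a \<notin> R \<longrightarrow> u $ a = 0"
      using that by (auto simp: u_def)
    have "0 < c * (u \<bullet> (A *v u)) + u \<bullet> (B *v u)"
    proof (cases "u \<in> K")
      case False
      then have "0 < u \<bullet> (B *v u)" using u by (auto simp: K_def W_def)
      moreover have "0 \<le> c * (u \<bullet> (A *v u))" using A[OF u(2)] c(1) by simp
      ultimately show ?thesis by linarith
    qed (rule c(2))
    also have "\<dots> = u \<bullet> ((c *\<^sub>R A + B) *v u)"
      by (simp add: matrix_vector_mult_add_rdistrib scaleR_matrix_vector_assoc[symmetric] inner_add_right)
    also have "\<dots> = (v \<bullet> ((c *\<^sub>R A + B) *v v)) / (norm v)\<^sup>2"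
      by (simp add: u_def matrix_vector_mult_scaleR power2_eq_square divide_inverse mult_ac)
    finally show ?thesis using \<open>v \<noteq> 0\<close> by (simp add: zero_less_divide_iff)
  qed
  then have "pos_def_on R (c *\<^sub>R A + B)"
    using sym unfolding pos_def_on_def by (simp add: sym_mats_nth)
  then show ?thesis using that c(1) by blast
qed


subsection \<open>Congruences acting within a set of indices\<close>

text \<open>\<open>T\<close> is the direct sum of an arbitrary block on \<open>W\<close> and the
  identity on the complement, so a congruence by \<open>T\<close> mixes only the rows and columns in
  \<open>W\<close>.\<close>

definition acts_within :: "'n set \<Rightarrow> real^'n^'n \<Rightarrow> bool" where
  "acts_within W T \<longleftrightarrow> (\<forall>a b. \<not> (a \<in> W \<and> b \<in> W) \<longrightarrow> T $ a $ b = (if a = b then 1 else 0))"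

lemma acts_withinD: "acts_within W T \<Longrightarrow> T $ a $ b \<noteq> 0 \<Longrightarrow> a = b \<or> a \<in> W \<and> b \<in> W"
  unfolding acts_within_def by metis

lemma acts_within_outside:
  "acts_within W T \<Longrightarrow> a \<notin> W \<or> b \<notin> W \<Longrightarrow> T $ a $ b = (if a = b then 1 else 0)"
  unfolding acts_within_def by metis

lemma acts_within_mono: "acts_within W T \<Longrightarrow> W \<subseteq> V \<Longrightarrow> acts_within V T"
  unfolding acts_within_def by blast

lemma acts_within_mult:
  fixes S T :: "real^'n^'n"
  assumes S: "acts_within W S" and T: "acts_within W T"
  shows "acts_within W (S ** T)"
  unfolding acts_within_def
proof (intro allI impI)
  fix a b assume "\<not> (a \<in> W \<and> b \<in> W)"
  then have "S $ a $ c * T $ c $ b = (if c = a then if a = b then 1 else 0 else 0)" for c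
    using acts_within_outside[OF S, of a c] acts_within_outside[OF T, of c b]
    by (cases "a \<in> W") (auto split: if_splits dest: acts_withinD[OF S] acts_withinD[OF T])
  then show "(S ** T) $ a $ b = (if a = b then 1 else 0)"
    by (simp add: matrix_matrix_mult_def)
qed

lemma acts_within_vector_outside:
  fixes T :: "real^'n^'n"
  assumes T: "acts_within W T" and "a \<notin> W"
  shows "(T *v v) $ a = v $ a"
proof -
  have "T $ a $ c * v $ c = (if c = a then v $ a else 0)" for c
    using acts_within_outside[OF T, of a c] \<open>a \<notin> W\<close> by auto
  then show ?thesis by (simp add: matrix_vector_mult_def)
qed

lemma congruence_outside:
  fixes S T :: "real^'n^'n"
  assumes T: "acts_within W T" and "a \<notin> W" "b \<notin> W"
  shows "(transpose T ** S ** T) $ a $ b = S $ a $ b"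
proof -
  have "(transpose T ** S ** T) $ a $ b =
      (\<Sum>c\<in>UNIV. \<Sum>e\<in>UNIV. if e = b then if c = a then S $ a $ b else 0 else 0)"
    unfolding congruence_nth
    by (intro sum.cong[OF HOL.refl]) (use assms in \<open>auto simp: acts_within_outside\<close>)
  then show ?thesis by simp
qed

text \<open>An entry of the congruent matrix sums \<open>S $ c $ e * T $ c $ a * T $ e $ b\<close>,
  and the factor \<open>T $ c $ a\<close> can be nonzero only if \<open>c = a\<close> or both lie in
  \<open>W\<close>; likewise for \<open>e\<close> and \<open>b\<close>.\<close>

lemma congruence_zero:
  fixes S T :: "real^'n^'n"
  assumes T: "acts_within W T"
    and zero: "\<And>c e. c = a \<or> c \<in> W \<and> a \<in> W \<Longrightarrow> e = b \<or> e \<in> W \<and> b \<in> W \<Longrightarrow> S $ c $ e = 0"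
  shows "(transpose T ** S ** T) $ a $ b = 0"
  unfolding congruence_nth
  using zero acts_withinD[OF T] by (intro sum.neutral ballI) (metis mult_zero_left mult_zero_right)

text \<open>Lets the same maximum rank solution serve before and after the congruence that
  diagonalizes a merged block.\<close>

lemma congruence_supported_outside:
  fixes X T :: "real^'n^'n"
  assumes T: "acts_within W T" and X: "X \<in> supported_on R" and R: "R \<inter> W = {}"
  shows "T ** X ** transpose T = X"
proof -
  have "(T ** X ** transpose T) $ a $ b = X $ a $ b" for a b
  proof -
    have "(T ** X ** transpose T) $ a $ b =
        (\<Sum>c\<in>UNIV. \<Sum>e\<in>UNIV. X $ c $ e * T $ a $ c * T $ b $ e)"
      using congruence_nth[of "transpose T" X a b] by (simp add: transpose_def)
    also have "\<dots> = (\<Sum>c\<in>UNIV. \<Sum>e\<in>UNIV. if e = b then if c = a then X $ a $ b else 0 else 0)"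
    proof (intro sum.cong[OF HOL.refl])
      fix c e
      show "X $ c $ e * T $ a $ c * T $ b $ e = (if e = b then if c = a then X $ a $ b else 0 else 0)"
      proof (cases "X $ c $ e = 0")
        case False
        then have "c \<notin> W" "e \<notin> W" using X R by (auto simp: supported_on_def)
        then show ?thesis by (auto simp: acts_within_outside[OF T])
      qed auto
    qed
    finally show ?thesis by simp
  qed
  then show ?thesis by (simp add: vec_eq_iff)
qed

lemma pos_def_on_congruence:
  fixes S T :: "real^'n^'n"
  assumes S: "S \<in> sym_mats" "pos_def_on W S" and T: "invertible T" "acts_within W T"
  shows "pos_def_on W (transpose T ** S ** T)"
proof -
  have "0 < v \<bullet> ((transpose T ** S ** T) *v v)" if "v \<noteq> 0" "\<forall>a. a \<notin> W \<longrightarrow> v $ a = 0" for v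
  proof -
    have "T *v v \<noteq> 0"
      using that(1) T(1) by (metis invertible_def matrix_left_invertible_ker)
    moreover have "\<forall>a. a \<notin> W \<longrightarrow> (T *v v) $ a = 0"
      using that(2) T(2) by (simp add: acts_within_vector_outside)
    ultimately show ?thesis
      using S(2) unfolding inner_congruence pos_def_on_def by blast
  qed
  then show ?thesis
    using sym_mats_congruence[OF S(1)] unfolding pos_def_on_def by (blast intro: sym_mats_nth)
qed

text \<open>Cholesky: one pivot \<open>a\<close> is eliminated from the remaining indices, then induction.\<close>

lemma pos_def_on_diagonalize:
  fixes S :: "real^'n^'n"
  assumes "S \<in> sym_mats" "pos_def_on W S"
  obtains T where "invertible T" "acts_within W T"
    "\<And>a b. a \<in> W \<Longrightarrow> b \<in> W \<Longrightarrow> a \<noteq> b \<Longrightarrow> (transpose T ** S ** T) $ a $ b = 0"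
proof -
  have "finite W" by simp
  then have "\<exists>T. invertible T \<and> acts_within W T \<and>
      (\<forall>a\<in>W. \<forall>b\<in>W. a \<noteq> b \<longrightarrow> (transpose T ** S ** T) $ a $ b = 0)"
    using assms
  proof (induction W arbitrary: S rule: finite_induct)
    case empty
    show ?case
      by (intro exI[of _ "mat 1"] conjI) (auto simp: invertible_def, simp add: acts_within_def mat_def)
  next
    case (insert a W)
    define p where "p = S $ a $ a"
    have p: "0 < p" using insert.prems(2) pos_def_on_diag unfolding p_def by blast
    define w where "w b = (if b \<in> W then S $ a $ b / p else 0)" for b
    have wa: "w a = 0" using insert.hyps by (simp add: w_def)
    \<comment> \<open>\<open>U\<close> is the identity minus the outer product of
      \<open>axis a 1\<close> and \<open>w\<close>, the elimination with pivot \<open>p\<close>.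
      Because \<open>w a = 0\<close>, flipping the sign of \<open>w\<close> gives the inverse
      \<open>U'\<close>.\<close>
    define U :: "real^'n^'n" where "U = (\<chi> c b. (if c = b then 1 else 0) - (if c = a then w b else 0))"
    define U' :: "real^'n^'n" where "U' = (\<chi> c b. (if c = b then 1 else 0) + (if c = a then w b else 0))"
    have U: "(U ** Z) $ c $ b = Z $ c $ b - (if c = a then \<Sum>e\<in>UNIV. w e * Z $ e $ b else 0)" for Z :: "real^'n^'n" and c b
      by (auto simp: U_def matrix_matrix_mult_def left_diff_distrib sum_subtractf if_distrib[of "\<lambda>x. x * _"] cong: if_cong)
    have U': "(U' ** Z) $ c $ b = Z $ c $ b + (if c = a then \<Sum>e\<in>UNIV. w e * Z $ e $ b else 0)" for Z :: "real^'n^'n" and c b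
      by (auto simp: U'_def matrix_matrix_mult_def distrib_right sum.distrib if_distrib[of "\<lambda>x. x * _"] cong: if_cong)
    have we: "(\<Sum>e\<in>UNIV. w e * U' $ e $ b) = w b" "(\<Sum>e\<in>UNIV. w e * U $ e $ b) = w b" for b
    proof -
      have "w e * U' $ e $ b = (if e = b then w b else 0)" "w e * U $ e $ b = (if e = b then w b else 0)" for e
        using wa by (auto simp: U'_def U_def)
      then show "(\<Sum>e\<in>UNIV. w e * U' $ e $ b) = w b" "(\<Sum>e\<in>UNIV. w e * U $ e $ b) = w b" by auto
    qed
    have "U ** U' = mat 1" "U' ** U = mat 1"
      unfolding vec_eq_iff U U' we by (auto simp: U_def U'_def mat_def)
    then have inv: "invertible U" unfolding invertible_def by blast
    have act: "acts_within (insert a W) U" by (auto simp: acts_within_def U_def w_def)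
    define S' where "S' = transpose U ** S ** U"
    have sym': "S' \<in> sym_mats" unfolding S'_def by (intro sym_mats_congruence insert.prems)
    have pd': "pos_def_on (insert a W) S'"
      unfolding S'_def by (intro pos_def_on_congruence insert.prems inv act)
    have S'a: "S' $ a $ b = 0" if b: "b \<in> W" for b
    proof -
      have "S' $ a $ b = (\<Sum>c\<in>UNIV. \<Sum>e\<in>UNIV. if c = a then S $ c $ e * U $ e $ b else 0)"
        unfolding S'_def congruence_nth by (intro sum.cong[OF HOL.refl]) (auto simp: U_def wa)
      also have "\<dots> = (\<Sum>e\<in>UNIV. S $ a $ e * U $ e $ b)"
        by (subst sum.swap) simp
      also have "\<dots> = (\<Sum>e\<in>UNIV. (if e = b then S $ a $ b else 0) - (if e = a then S $ a $ a * w b else 0))"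
        by (intro sum.cong[OF HOL.refl]) (auto simp: U_def algebra_simps)
      also have "\<dots> = S $ a $ b - S $ a $ a * w b"
        by (simp add: sum_subtractf)
      also have "\<dots> = 0" using p b by (simp add: w_def p_def[symmetric])
      finally show ?thesis .
    qed
    have "pos_def_on W S'" using pd' unfolding pos_def_on_def by (meson insertI2 insert_iff)
    then obtain T where T: "invertible T" "acts_within W T"
      "\<And>c b. c \<in> W \<Longrightarrow> b \<in> W \<Longrightarrow> c \<noteq> b \<Longrightarrow> (transpose T ** S' ** T) $ c $ b = 0"
      using insert.IH[OF sym'] by blast
    \<comment> \<open>Since \<open>a\<close> is outside \<open>W\<close>, the congruence from the
      induction hypothesis only recombines the zeros already produced in row
      \<open>a\<close>.\<close>
    have Ta: "(transpose T ** S' ** T) $ a $ b = 0" if "b \<in> W" for b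
      by (rule congruence_zero[OF T(2)]) (use that insert.hyps S'a in auto)
    have Ts: "transpose T ** S' ** T \<in> sym_mats" by (intro sym_mats_congruence sym')
    have "transpose (U ** T) ** S ** (U ** T) = transpose T ** S' ** T"
      by (simp add: S'_def matrix_transpose_mul matrix_mul_assoc)
    moreover have "(transpose T ** S' ** T) $ c $ b = 0"
      if "c \<in> insert a W" "b \<in> insert a W" "c \<noteq> b" for c b
      using that T(3) Ta sym_mats_nth[OF Ts, of c b] by auto
    moreover have "acts_within (insert a W) (U ** T)"
      by (intro acts_within_mult act acts_within_mono[OF T(2)]) auto
    moreover have "invertible (U ** T)" by (intro invertible_mult inv T)
    ultimately show ?case by metis
  qed
  then show ?thesis using that by blast
qed


subsection \<open>Regular facial reduction sequences\<close>

text \<open>The indices on which the \<open>i\<close>-th matrix is constrained. Counting starts at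
  1, so \<open>unreduced P (Suc t)\<close> is what \<open>t\<close> matrices leave over, the extra
  block with index \<open>t + 1\<close>.\<close>

definition unreduced :: "(nat \<Rightarrow> 'n set) \<Rightarrow> nat \<Rightarrow> 'n set" where
  "unreduced P i = - (\<Union>j\<in>{1..<i}. P j)"

lemma unreduced_1: "unreduced P 1 = UNIV" "unreduced P (Suc 0) = UNIV"
  by (simp_all add: unreduced_def)

lemma unreduced_Suc: "1 \<le> i \<Longrightarrow> unreduced P (Suc i) = unreduced P i - P i"
  by (auto simp: unreduced_def less_Suc_eq)

lemma unreduced_antimono: "i \<le> j \<Longrightarrow> unreduced P j \<subseteq> unreduced P i"
  unfolding unreduced_def by fastforce

lemma regular_fr_seq_sym: "regular_fr_seq t Y P \<Longrightarrow> i \<in> {1..t} \<Longrightarrow> Y i \<in> sym_mats"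
  by (simp add: regular_fr_seq_def)

lemma regular_fr_seq_disjoint:
  "regular_fr_seq t Y P \<Longrightarrow> i \<in> {1..t} \<Longrightarrow> j \<in> {1..t} \<Longrightarrow> i \<noteq> j \<Longrightarrow> P i \<inter> P j = {}"
  unfolding regular_fr_seq_def disjoint_family_on_def by blast

lemma regular_fr_seq_block_unreduced:
  assumes "regular_fr_seq t Y P" "i \<in> {1..t}" "j \<le> i"
  shows "P i \<subseteq> unreduced P j"
proof -
  have "P i \<inter> P l = {}" if "l \<in> {1..<j}" for l
    using that assms regular_fr_seq_disjoint[of t Y P i l] by auto
  then show ?thesis unfolding unreduced_def by blast
qed

lemma regular_fr_seq_diag_pos:
  "regular_fr_seq t Y P \<Longrightarrow> i \<in> {1..t} \<Longrightarrow> a \<in> P i \<Longrightarrow> 0 < Y i $ a $ a"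
  using pos_def_on_diag[of "P i" "Y i" a] by (simp add: regular_fr_seq_def)

lemma regular_fr_seq_zero:
  assumes "regular_fr_seq t Y P" "i \<in> {1..t}" "a \<in> unreduced P i" "b \<in> unreduced P i"
    "\<not> (a = b \<and> a \<in> P i)"
  shows "Y i $ a $ b = 0"
  using assms unfolding regular_fr_seq_def unreduced_def by (metis Compl_iff)

lemma regular_fr_seqI:
  assumes "\<And>i. i \<in> {1..t} \<Longrightarrow> Y i \<in> sym_mats"
    and sub: "\<And>i. i \<in> {1..t} \<Longrightarrow> P i \<subseteq> unreduced P i"
    and diag: "\<And>i a. i \<in> {1..t} \<Longrightarrow> a \<in> P i \<Longrightarrow> 0 < Y i $ a $ a"
    and zero: "\<And>i a b. i \<in> {1..t} \<Longrightarrow> a \<in> unreduced P i \<Longrightarrow> b \<in> unreduced P i \<Longrightarrow>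
      \<not> (a = b \<and> a \<in> P i) \<Longrightarrow> Y i $ a $ b = 0"
  shows "regular_fr_seq t Y P"
proof -
  have disj_less: "P i \<inter> P j = {}" if "i \<in> {1..t}" "j \<in> {1..t}" "i < j" for i j
  proof -
    have "i \<in> {1..<j}" using that by simp
    then show ?thesis using sub[OF that(2)] unfolding unreduced_def by blast
  qed
  have disj: "P i \<inter> P j = {}" if "i \<in> {1..t}" "j \<in> {1..t}" "i \<noteq> j" for i j
    using disj_less[of i j] disj_less[of j i] that by (cases "i < j") auto
  have off: "Y i $ a $ b = 0" if "i \<in> {1..t}" "a \<in> P i" "b \<in> P i" "a \<noteq> b" for i a b
    using that sub zero by blast
  have "pos_def_on (P i) (Y i)" if "i \<in> {1..t}" for i
    using that off diag by (intro pos_def_on_diagonal) auto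
  moreover have "Y i $ a $ b = 0"
    if "i \<in> {1..t}" "a \<notin> (\<Union>j\<in>{1..<i}. P j)" "b \<notin> (\<Union>j\<in>{1..<i}. P j)" "\<not> (a \<in> P i \<and> b \<in> P i)" for i a b
    using that zero[of i a b] by (auto simp: unreduced_def)
  ultimately show ?thesis
    using assms(1) disj off unfolding regular_fr_seq_def disjoint_family_on_def by blast
qed

text \<open>The arbitrary rows and columns of \<open>Y i\<close> belong to earlier blocks, where
  \<open>v\<close> vanishes; what is left of \<open>Y i\<close> is its positive diagonal on
  \<open>P i\<close>.\<close>

lemma regular_fr_seq_quadratic_form:
  fixes Y :: "nat \<Rightarrow> real^'n^'n"
  assumes Y: "regular_fr_seq t Y P" "i \<in> {1..t}"
    and v: "\<forall>a. a \<notin> unreduced P i \<longrightarrow> v $ a = 0"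
  shows "v \<bullet> (Y i *v v) = (\<Sum>a\<in>P i. Y i $ a $ a * (v $ a)\<^sup>2)"
proof -
  have "v \<bullet> (Y i *v v) = (\<Sum>a\<in>UNIV. \<Sum>b\<in>UNIV. if b = a then if a \<in> P i then Y i $ a $ a * (v $ a)\<^sup>2 else 0 else 0)"
    unfolding inner_matrix_vector
  proof (intro sum.cong[OF HOL.refl])
    fix a b
    show "Y i $ a $ b * v $ a * v $ b = (if b = a then if a \<in> P i then Y i $ a $ a * (v $ a)\<^sup>2 else 0 else 0)"
      using regular_fr_seq_zero[OF Y, of a b] v
      by (cases "a \<in> unreduced P i \<and> b \<in> unreduced P i")
        (auto simp: power2_eq_square dest: subsetD[OF regular_fr_seq_block_unreduced[OF Y order_refl]])
  qed
  also have "\<dots> = (\<Sum>a\<in>P i. Y i $ a $ a * (v $ a)\<^sup>2)"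
    by (simp add: sum.If_cases)
  finally show ?thesis .
qed

lemma regular_fr_seq_quadratic_form_nonneg:
  fixes Y :: "nat \<Rightarrow> real^'n^'n"
  assumes Y: "regular_fr_seq t Y P" "i \<in> {1..t}"
    and v: "\<forall>a. a \<notin> unreduced P i \<longrightarrow> v $ a = 0"
  shows "0 \<le> v \<bullet> (Y i *v v)"
  unfolding regular_fr_seq_quadratic_form[OF assms]
  using regular_fr_seq_diag_pos[OF Y] by (intro sum_nonneg mult_nonneg_nonneg) (auto simp: less_imp_le)

lemma regular_fr_seq_quadratic_form_eq_0:
  fixes Y :: "nat \<Rightarrow> real^'n^'n"
  assumes Y: "regular_fr_seq t Y P" "i \<in> {1..t}"
    and v: "\<forall>a. a \<notin> unreduced P i \<longrightarrow> v $ a = 0"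
    and zero: "v \<bullet> (Y i *v v) = 0" and a: "a \<in> P i"
  shows "v $ a = 0"
proof -
  have "Y i $ a $ a * (v $ a)\<^sup>2 = 0"
    using zero a regular_fr_seq_diag_pos[OF Y]
    unfolding regular_fr_seq_quadratic_form[OF Y v]
    by (subst (asm) sum_nonneg_eq_0_iff) (auto intro!: mult_nonneg_nonneg intro: less_imp_le)
  then show ?thesis using regular_fr_seq_diag_pos[OF Y a] by simp
qed

text \<open>Once \<open>X\<close> is supported off the earlier blocks, its inner product with the
  next matrix is a sum of nonnegative diagonal terms over the next block. Orthogonality makes them
  vanish, and semidefiniteness then clears their rows and columns.\<close>

lemma reduced_cone_regular:
  fixes Y :: "nat \<Rightarrow> real^'n^'n"
  assumes Y: "regular_fr_seq t Y P"
  shows "reduced_cone t Y = psd_cone \<inter> supported_on (unreduced P (Suc t))"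
proof (intro equalityI subsetI)
  fix X assume X: "X \<in> reduced_cone t Y"
  then have psd: "X \<in> psd_cone" and perp: "\<And>i. i \<in> {1..t} \<Longrightarrow> mat_inner (Y i) X = 0"
    by (auto simp: reduced_cone_def mat_perp_def)
  have sym: "X $ a $ b = X $ b $ a" for a b
    using psd by (intro sym_mats_nth) (simp add: psd_cone_def)
  have "X \<in> supported_on (unreduced P (Suc i))" if "i \<le> t" for i
    using that
  proof (induction i)
    case 0
    show ?case by (simp add: unreduced_1 supported_on_def)
  next
    case (Suc i)
    then have i: "Suc i \<in> {1..t}" and supp: "X \<in> supported_on (unreduced P (Suc i))" by auto
    have "mat_inner (Y (Suc i)) X =
      (\<Sum>a\<in>UNIV. \<Sum>b\<in>UNIV. if b = a then if a \<in> P (Suc i) then Y (Suc i) $ a $ a * X $ a $ a else 0 else 0)"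
      unfolding mat_inner_sum
    proof (intro sum.cong[OF HOL.refl])
      fix a b
      show "Y (Suc i) $ a $ b * X $ b $ a =
          (if b = a then if a \<in> P (Suc i) then Y (Suc i) $ a $ a * X $ a $ a else 0 else 0)"
        using supp regular_fr_seq_zero[OF Y i, of a b] unfolding supported_on_def
        by (cases "X $ b $ a = 0") auto
    qed
    then have "mat_inner (Y (Suc i)) X = (\<Sum>a\<in>P (Suc i). Y (Suc i) $ a $ a * X $ a $ a)"
      by (simp add: sum.If_cases)
    then have "(\<Sum>a\<in>P (Suc i). Y (Suc i) $ a $ a * X $ a $ a) = 0"
      using perp[OF i] by simp
    then have "\<forall>a\<in>P (Suc i). Y (Suc i) $ a $ a * X $ a $ a = 0"
      using regular_fr_seq_diag_pos[OF Y i] psd_cone_diag_nonneg[OF psd]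
      by (subst (asm) sum_nonneg_eq_0_iff) (auto intro!: mult_nonneg_nonneg intro: less_imp_le)
    then have row: "X $ a $ b = 0" if "a \<in> P (Suc i)" for a b
      by - (rule psd_cone_row_zero[OF psd], use that regular_fr_seq_diag_pos[OF Y i that] in fastforce)
    have "a \<in> unreduced P (Suc i) - P (Suc i) \<and> b \<in> unreduced P (Suc i) - P (Suc i)"
      if "X $ a $ b \<noteq> 0" for a b
      using that supp row[of a b] row[of b a] sym[of a b] unfolding supported_on_def by auto
    then show ?case
      by (simp add: supported_on_def unreduced_Suc)
  qed
  then show "X \<in> psd_cone \<inter> supported_on (unreduced P (Suc t))" using psd by blast
next
  fix X assume X: "X \<in> psd_cone \<inter> supported_on (unreduced P (Suc t))"
  have "mat_inner (Y i) X = 0" if i: "i \<in> {1..t}" for i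
    unfolding mat_inner_sum
  proof (intro sum.neutral ballI)
    fix a b
    have "Y i $ a $ b = 0" if "X $ b $ a \<noteq> 0"
    proof (rule regular_fr_seq_zero[OF Y i])
      have "a \<in> unreduced P (Suc t)" "b \<in> unreduced P (Suc t)"
        using X that by (auto simp: supported_on_def)
      moreover have "unreduced P (Suc t) \<subseteq> unreduced P (Suc i)" "unreduced P (Suc i) = unreduced P i - P i"
        using i by (auto intro!: unreduced_antimono unreduced_Suc)
      ultimately show "a \<in> unreduced P i" "b \<in> unreduced P i" "\<not> (a = b \<and> a \<in> P i)" by auto
    qed
    then show "Y i $ a $ b * X $ b $ a = 0" by auto
  qed
  then show "X \<in> reduced_cone t Y"
    using X by (auto simp: reduced_cone_def mat_perp_def psd_cone_def)
qed

lemma supported_on_subset_iff: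
  fixes R S :: "'n::finite set"
  shows "psd_cone \<inter> supported_on R \<subseteq> psd_cone \<inter> supported_on S \<longleftrightarrow> R \<subseteq> S"
proof
  assume sub: "psd_cone \<inter> supported_on R \<subseteq> psd_cone \<inter> supported_on S"
  show "R \<subseteq> S"
  proof
    fix a assume "a \<in> R"
    then have "axis a (axis a 1) \<in> supported_on S" using axis_outer_psd sub by blast
    then show "a \<in> S" unfolding supported_on_def by (metis (mono_tags, lifting) axis_nth mem_Collect_eq zero_neq_one)
  qed
qed (auto simp: supported_on_def)

text \<open>Faces determine their index sets, by the matrix units. This identifies
  \<open>last_indices r\<close> of an RR form with the indices left over by its certificate.\<close>

lemma regular_fr_seq_unreduced_eq:
  assumes "regular_fr_seq t Y P" "reduced_cone t Y = psd_cone \<inter> supported_on R"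
  shows "unreduced P (Suc t) = R"
  using assms(2) unfolding reduced_cone_regular[OF assms(1)]
  by (intro subset_antisym) (simp_all flip: supported_on_subset_iff)


subsection \<open>Reformulations\<close>

text \<open>Exchanges and combinations commute with congruences, so all rotations collect into a
  single \<open>T\<close>. The right-hand sides are tracked through feasibility.\<close>

lemma reformulation_span_feasible:
  fixes M M' :: "nat \<Rightarrow> real^'n^'n"
  assumes "reformulation m M d M' d'"
  shows "\<exists>T. invertible T \<and>
    (\<forall>i\<in>{1..m}. \<exists>g. M' i = transpose T ** (\<Sum>t=1..m. g t *\<^sub>R M t) ** T) \<and>
    (\<forall>X. feasible m M' d' X \<longrightarrow> feasible m M d (T ** X ** transpose T))"
  using assms
proof induction
  case refl
  have "\<exists>g. M i = (\<Sum>t=1..m. g t *\<^sub>R M t)" if "i \<in> {1..m}" for i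
    using that by (intro exI[of _ "\<lambda>t. if t = i then 1 else 0"]) (simp add: if_distrib[of "\<lambda>x. x *\<^sub>R _"] cong: if_cong)
  moreover have "invertible (mat 1 :: real^'n^'n)" by (auto simp: invertible_def)
  ultimately show ?case by (intro exI[of _ "mat 1"]) simp
next
  case (rotate M' d' U)
  then obtain T where T: "invertible T"
    "\<forall>i\<in>{1..m}. \<exists>g. M' i = transpose T ** (\<Sum>t=1..m. g t *\<^sub>R M t) ** T"
    "\<forall>X. feasible m M' d' X \<longrightarrow> feasible m M d (T ** X ** transpose T)" by blast
  have "invertible (T ** U)" using T(1) rotate by (intro invertible_mult)
  moreover have "\<exists>g. transpose U ** M' i ** U = transpose (T ** U) ** (\<Sum>t=1..m. g t *\<^sub>R M t) ** (T ** U)"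
    if i: "i \<in> {1..m}" for i
  proof -
    obtain g where "M' i = transpose T ** (\<Sum>t=1..m. g t *\<^sub>R M t) ** T" using T(2) i by blast
    then show ?thesis by (intro exI[of _ g]) (simp add: matrix_transpose_mul matrix_mul_assoc)
  qed
  moreover have "feasible m M d ((T ** U) ** X ** transpose (T ** U))"
    if "feasible m (\<lambda>i. transpose U ** M' i ** U) d' X" for X
  proof -
    have "feasible m M' d' (U ** X ** transpose U)"
      using that unfolding feasible_def by (simp add: mat_inner_congruence psd_cone_congruence)
    from T(3)[rule_format, OF this] show ?thesis by (simp add: matrix_transpose_mul matrix_mul_assoc)
  qed
  ultimately show ?case by blast
next
  case (exchange M' d' i j)
  then obtain T where T: "invertible T"
    "\<forall>i\<in>{1..m}. \<exists>g. M' i = transpose T ** (\<Sum>t=1..m. g t *\<^sub>R M t) ** T"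
    "\<forall>X. feasible m M' d' X \<longrightarrow> feasible m M d (T ** X ** transpose T)" by blast
  have "feasible m M' d' X" if X: "feasible m (M'(i := M' j, j := M' i)) (d'(i := d' j, j := d' i)) X" for X
    unfolding feasible_def
  proof (intro conjI ballI)
    show "X \<in> psd_cone" using X by (simp add: feasible_def)
    fix l assume "l \<in> {1..m}"
    then show "mat_inner (M' l) X = d' l"
      using X exchange.hyps unfolding feasible_def by (metis fun_upd_apply)
  qed
  moreover have "\<exists>g. (M'(i := M' j, j := M' i)) l = transpose T ** (\<Sum>t=1..m. g t *\<^sub>R M t) ** T"
    if "l \<in> {1..m}" for l
    using that exchange.hyps T(2) by simp
  ultimately show ?case using T by blast
next
  case (combine M' d' i y)
  then obtain T where T: "invertible T"
    "\<forall>i\<in>{1..m}. \<exists>g. M' i = transpose T ** (\<Sum>t=1..m. g t *\<^sub>R M t) ** T"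
    "\<forall>X. feasible m M' d' X \<longrightarrow> feasible m M d (T ** X ** transpose T)" by blast
  obtain g where g: "\<And>i. i \<in> {1..m} \<Longrightarrow> M' i = transpose T ** (\<Sum>t=1..m. g i t *\<^sub>R M t) ** T"
    using T(2) by metis
  define h where "h t = (\<Sum>s=1..m. y s * g s t)" for t
  have lin: "transpose T ** (\<Sum>s\<in>A. c s *\<^sub>R B s) ** T = (\<Sum>s\<in>A. c s *\<^sub>R (transpose T ** B s ** T))"
    for A :: "nat set" and c and B :: "nat \<Rightarrow> real^'n^'n"
    by (induction A rule: infinite_finite_induct)
      (simp_all add: vec_eq_iff congruence_nth sum.distrib distrib_right sum_distrib_left mult.assoc)
  have "(\<Sum>t=1..m. y t *\<^sub>R M' t) = (\<Sum>s=1..m. y s *\<^sub>R (transpose T ** (\<Sum>t=1..m. g s t *\<^sub>R M t) ** T))"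
    by (intro sum.cong) (simp_all add: g)
  also have "\<dots> = transpose T ** (\<Sum>s=1..m. y s *\<^sub>R (\<Sum>t=1..m. g s t *\<^sub>R M t)) ** T"
    by (simp only: lin)
  also have "(\<Sum>s=1..m. y s *\<^sub>R (\<Sum>t=1..m. g s t *\<^sub>R M t)) = (\<Sum>t=1..m. h t *\<^sub>R M t)"
    unfolding h_def scaleR_sum_left scaleR_sum_right by (subst sum.swap) simp
  finally have "\<exists>g. (M'(i := \<Sum>t=1..m. y t *\<^sub>R M' t)) l = transpose T ** (\<Sum>t=1..m. g t *\<^sub>R M t) ** T"
    if "l \<in> {1..m}" for l
    using that T(2) by (cases "l = i") auto
  moreover have "feasible m M' d' X"
    if X: "feasible m (M'(i := \<Sum>t=1..m. y t *\<^sub>R M' t)) (d'(i := \<Sum>t=1..m. y t * d' t)) X" for X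
  proof -
    have eqn: "mat_inner ((M'(i := \<Sum>t=1..m. y t *\<^sub>R M' t)) l) X = (d'(i := \<Sum>t=1..m. y t * d' t)) l"
      if "l \<in> {1..m}" for l
      using X that unfolding feasible_def by blast
    have other: "mat_inner (M' l) X = d' l" if "l \<in> {1..m}" "l \<noteq> i" for l
      using eqn[OF that(1)] that(2) by simp
    have "(\<Sum>t=1..m. y t * mat_inner (M' t) X) = (\<Sum>t=1..m. y t * d' t)"
      using eqn[OF combine.hyps(2)] by (simp add: mat_inner_sum_left mat_inner_scaleR_left)
    \<comment> \<open>All residuals except the \<open>i\<close>-th are zero, and \<open>y i\<close>
      is nonzero, so the replaced equation can be recovered.\<close>
    then have "(\<Sum>t=1..m. y t * (mat_inner (M' t) X - d' t)) = 0"
      by (simp add: right_diff_distrib sum_subtractf)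
    moreover have "(\<Sum>t=1..m. y t * (mat_inner (M' t) X - d' t)) = y i * (mat_inner (M' i) X - d' i)"
      using combine.hyps(2) other by (subst sum.remove[of _ i]) (auto intro!: sum.neutral)
    ultimately have "mat_inner (M' i) X = d' i" using combine.hyps(3) by simp
    then show ?thesis using X other unfolding feasible_def by blast
  qed
  ultimately show ?case using T by blast
qed

text \<open>A cyclic shift of the positions \<open>q\<close> to \<open>m\<close>. It takes an
  equation out of the certifying initial segment while keeping it in the system.\<close>

definition move_last :: "nat \<Rightarrow> nat \<Rightarrow> (nat \<Rightarrow> 'a) \<Rightarrow> nat \<Rightarrow> 'a" where
  "move_last q m f j = (if q \<le> j \<and> j < m then f (Suc j) else if j = m then f q else f j)"

text \<open>The shift is a product of adjacent exchanges; the induction runs downwards from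
  \<open>q = m\<close>, where the shift is trivial.\<close>

lemma reformulation_move_last:
  assumes "reformulation m M d M' d'" "1 \<le> q" "q \<le> m"
  shows "reformulation m M d (move_last q m M') (move_last q m d')"
  using assms(3,1,2)
proof (induction arbitrary: M' d' rule: inc_induct)
  case base
  have "move_last m m M' = M'" "move_last m m d' = d'" by (auto simp: move_last_def fun_eq_iff)
  then show ?case using base by simp
next
  case (step q)
  have eq: "move_last (Suc q) m (M'(q := M' (Suc q), Suc q := M' q)) = move_last q m M'"
    "move_last (Suc q) m (d'(q := d' (Suc q), Suc q := d' q)) = move_last q m d'"
    using step.hyps by (auto simp: move_last_def fun_eq_iff)
  have "reformulation m M d (M'(q := M' (Suc q), Suc q := M' q)) (d'(q := d' (Suc q), Suc q := d' q))"
    using step by (intro reformulation.exchange) auto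
  from step.IH[OF this] show ?case by (simp only: eq)
qed


subsection \<open>The singularity degree\<close>

text \<open>Rewrites the column set of a critical block as the indices left after \<open>i\<close>
  steps, which removes the special role of the block \<open>t + 1\<close> from later
  arguments.\<close>

lemma ext_structure_UN:
  assumes Y: "regular_fr_seq t Y P" and i: "i \<in> {1..t}"
  shows "(\<Union>j\<in>{i+1..t+1}. ext_structure t P j) = unreduced P (Suc i)"
proof (intro equalityI subsetI)
  fix b assume "b \<in> (\<Union>j\<in>{i+1..t+1}. ext_structure t P j)"
  then obtain j where j: "i + 1 \<le> j" "j \<le> t + 1" "b \<in> ext_structure t P j" by auto
  have "ext_structure t P j \<subseteq> unreduced P (Suc i)"
  proof (cases "j = t + 1")
    case True
    then have "ext_structure t P j = unreduced P (Suc t)"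
      by (auto simp: ext_structure_def unreduced_def)
    then show ?thesis using i unreduced_antimono[of "Suc i" "Suc t" P] by simp
  next
    case False
    then show ?thesis using j regular_fr_seq_block_unreduced[OF Y, of j "Suc i"]
      by (simp add: ext_structure_def)
  qed
  then show "b \<in> unreduced P (Suc i)" using j by blast
next
  fix b assume b: "b \<in> unreduced P (Suc i)"
  show "b \<in> (\<Union>j\<in>{i+1..t+1}. ext_structure t P j)"
  proof (cases "\<exists>j\<in>{1..t}. b \<in> P j")
    case True
    then obtain j where j: "j \<in> {1..t}" "b \<in> P j" by blast
    then have "\<not> j < Suc i" using b by (auto simp: unreduced_def)
    then show ?thesis using j by (intro UN_I[of j]) (auto simp: ext_structure_def)
  next
    case False
    then show ?thesis using i by (intro UN_I[of "t + 1"]) (auto simp: ext_structure_def)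
  qed
qed

section \<open>Lower bound on the number of certifying equations\<close>

lemma regular_fr_seq_reduced_zero:
  assumes Y: "regular_fr_seq t Y P" and i: "i \<in> {1..t}" "i < j"
    and ab: "a \<in> unreduced P j" "b \<in> unreduced P i"
  shows "Y i $ a $ b = 0"
proof (rule regular_fr_seq_zero[OF Y i(1)])
  have "unreduced P j \<subseteq> unreduced P (Suc i)" "unreduced P (Suc i) = unreduced P i - P i"
    using i by (auto intro!: unreduced_antimono unreduced_Suc)
  then show "a \<in> unreduced P i" "b \<in> unreduced P i" "\<not> (a = b \<and> a \<in> P i)" using ab by auto
qed

text \<open>
  The last matrix \<open>Y\<^sub>s\<close> that occurs in the combination vanishes on the diagonal of the columns of its
  critical block, and the earlier matrices vanish on that block altogether. So a psd combination
  cannot reach beyond the current index \<open>j\<close>.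
\<close>

lemma psd_combination_coeff_zero:
  fixes Y :: "nat \<Rightarrow> real^'n^'n"
  assumes Y: "regular_fr_seq m Y P"
    and crit: "\<forall>i\<in>{2..m}. \<not> block_zero (Y i) (P (i - 1)) (\<Union>j\<in>{i+1..m+1}. ext_structure m P j)"
    and j: "1 \<le> j"
    and psd: "\<And>v. (\<forall>a. a \<notin> unreduced P j \<longrightarrow> v $ a = 0) \<Longrightarrow> 0 \<le> v \<bullet> ((\<Sum>t=1..m. g t *\<^sub>R Y t) *v v)"
    and t: "t \<in> {1..m}" "j < t"
  shows "g t = 0"
proof (rule ccontr)
  define Z where "Z = (\<Sum>t=1..m. g t *\<^sub>R Y t)"
  define s where "s = Max {t \<in> {1..m}. g t \<noteq> 0}"
  assume "g t \<noteq> 0"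
  then have ne: "{t \<in> {1..m}. g t \<noteq> 0} \<noteq> {}" and "t \<le> s"
    using t by (auto simp: s_def intro!: Max_ge)
  then have s: "s \<in> {1..m}" "g s \<noteq> 0" "j < s"
    using Max_in[of "{t \<in> {1..m}. g t \<noteq> 0}"] t by (auto simp: s_def)
  have above: "g l = 0" if l: "l \<in> {1..m}" "s < l" for l
  proof (rule ccontr)
    assume "g l \<noteq> 0"
    then have "l \<le> s" unfolding s_def using l(1) by (intro Max_ge) auto
    then show False using l(2) by simp
  qed
  have "s \<in> {2..m}" using s j by auto
  with crit have "\<not> block_zero (Y s) (P (s - 1)) (\<Union>j\<in>{s+1..m+1}. ext_structure m P j)" by blast
  then obtain a b where ab: "a \<in> P (s - 1)" "b \<in> unreduced P (Suc s)" "Y s $ a $ b \<noteq> 0"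
    unfolding ext_structure_UN[OF Y s(1)] block_zero_def by blast
  have s1: "s - 1 \<in> {1..m}" using s j by auto
  have a: "a \<in> unreduced P i" if "i \<le> s - 1" for i
    using regular_fr_seq_block_unreduced[OF Y s1 that] ab(1) by blast
  have b: "b \<in> unreduced P i" if "i \<le> Suc s" for i
    using unreduced_antimono[OF that, of P] ab(2) by blast
  have Z: "Z $ c $ e = (\<Sum>l=1..m. g l * Y l $ c $ e)" for c e
    by (simp add: Z_def)
  have "Z \<in> sym_mats"
    unfolding Z_def by (intro sym_mats_sum sym_mats_scaleR regular_fr_seq_sym[OF Y])
  then have "Z $ b $ a = 0" if "Z $ b $ b = 0"
  proof (rule psd_on_row_zero)
    show "0 \<le> v \<bullet> (Z *v v)" if "\<forall>c. c \<notin> unreduced P j \<longrightarrow> v $ c = 0" for v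
      unfolding Z_def using that by (rule psd)
    \<comment> \<open>Here \<open>j < s\<close> matters: it gives \<open>j \<le> s - 1\<close>, so
      the row index \<open>a\<close> from \<open>P (s - 1)\<close> is still unreduced at stage
      \<open>j\<close>.\<close>
    show "b \<in> unreduced P j" "a \<in> unreduced P j" using a b s(3) by auto
  qed (rule that)
  moreover have "Z $ b $ b = 0"
    unfolding Z
  proof (intro sum.neutral ballI)
    fix l assume l: "l \<in> {1..m}"
    show "g l * Y l $ b $ b = 0"
    proof (cases "l \<le> s")
      case True
      then show ?thesis using regular_fr_seq_reduced_zero[OF Y l, of "Suc s" b b] b by simp
    qed (use above l in auto)
  qed
  moreover have "Z $ b $ a = g s * Y s $ b $ a"
  proof -
    \<comment> \<open>The case \<open>l = s - 1\<close> is included: \<open>a\<close> lies in the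
      diagonal block of that matrix, but \<open>b\<close> does not.\<close>
    have "g l * Y l $ b $ a = (if l = s then g s * Y s $ b $ a else 0)" if l: "l \<in> {1..m}" for l
    proof (cases "l < s")
      case True
      then have "Y l $ b $ a = 0"
        using regular_fr_seq_reduced_zero[OF Y l, of "Suc s" b a] a[of l] b by simp
      then show ?thesis using True by simp
    qed (use above[OF l] in auto)
    then have "Z $ b $ a = (\<Sum>l=1..m. if l = s then g s * Y s $ b $ a else 0)"
      unfolding Z by (rule sum.cong[OF HOL.refl])
    then show ?thesis using s(1) by simp
  qed
  moreover have "Y s $ b $ a = Y s $ a $ b"
    by (intro sym_mats_nth regular_fr_seq_sym[OF Y s(1)])
  ultimately show False using s(2) ab(3) by simp
qed

lemma certify_max_rank_minimal:
  assumes cert: "certify_max_rank m M d m" and crit: "critical_blocks_nonzero m M"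
    and last: "last_block_nonempty m M"
    and ref: "reformulation m M d M' d'" and cert': "certify_max_rank m M' d' k"
  shows "m \<le> k"
proof (rule ccontr)
  assume "\<not> m \<le> k"
  then have k: "k < m" by simp
  obtain P where P: "regular_fr_seq m M P"
    and crit: "\<forall>i\<in>{2..m}. \<not> block_zero (M i) (P (i - 1)) (\<Union>j\<in>{i+1..m+1}. ext_structure m P j)"
    using crit unfolding critical_blocks_nonzero_def by blast
  have d: "\<forall>i\<in>{1..m}. d i = 0" using cert unfolding certify_max_rank_def by blast
  obtain r Q X where Q: "regular_fr_seq k M' Q"
    and cone: "reduced_cone k M' = psd_cone \<inter> supported_on (last_indices r)"
    and X: "feasible m M' d' X" "pos_def_on (last_indices r) X" "X \<in> supported_on (last_indices r)"
    using cert' unfolding certify_max_rank_def by blast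
  have R: "last_indices r = unreduced Q (Suc k)"
    using regular_fr_seq_unreduced_eq[OF Q cone] by simp
  obtain T g where T: "invertible T"
    and g: "\<And>i. i \<in> {1..m} \<Longrightarrow> M' i = transpose T ** (\<Sum>t=1..m. g i t *\<^sub>R M t) ** T"
    and feas: "\<And>X. feasible m M' d' X \<Longrightarrow> feasible m M d (T ** X ** transpose T)"
    using reformulation_span_feasible[OF ref] by metis
  \<comment> \<open>The reformulated sequence never reduces faster than the original one, expressed
    through vectors and their images under \<open>T\<close>.\<close>
  have faces: "\<forall>a. a \<notin> unreduced Q (Suc j) \<longrightarrow> u $ a = 0"
    if "j \<le> k" "\<forall>a. a \<notin> unreduced P (Suc j) \<longrightarrow> (T *v u) $ a = 0" for j u
    using that
  proof (induction j arbitrary: u)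
    case 0
    then show ?case by (simp add: unreduced_1)
  next
    case (Suc j)
    define i where "i = Suc j"
    have i: "i \<in> {1..k}" "i \<in> {1..m}" "1 \<le> i" using Suc.prems(1) k by (auto simp: i_def)
    have IH: "\<forall>a. a \<notin> unreduced Q i \<longrightarrow> u $ a = 0"
      if "\<forall>a. a \<notin> unreduced P i \<longrightarrow> (T *v u) $ a = 0" for u
      using Suc.IH[of u] that Suc.prems(1) by (simp add: i_def)
    define Z where "Z = (\<Sum>t=1..m. g i t *\<^sub>R M t)"
    have quad: "u \<bullet> (M' i *v u) = (T *v u) \<bullet> (Z *v (T *v u))" for u
      unfolding g[OF i(2)] Z_def inner_congruence ..
    \<comment> \<open>By the induction hypothesis, a vector supported on
      \<open>unreduced P i\<close> is the image of one supported on \<open>unreduced Q i\<close>,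
      where the form of \<open>M' i\<close> is nonnegative.\<close>
    have psd: "0 \<le> v \<bullet> (Z *v v)" if v: "\<forall>a. a \<notin> unreduced P i \<longrightarrow> v $ a = 0" for v
    proof -
      obtain T' where "T ** T' = mat 1" using T unfolding invertible_def by blast
      then have Tv: "T *v (T' *v v) = v" by (simp add: matrix_vector_mul_assoc)
      then have "0 \<le> (T' *v v) \<bullet> (M' i *v (T' *v v))"
        using v by (intro regular_fr_seq_quadratic_form_nonneg[OF Q i(1)] IH) simp
      then show ?thesis by (simp add: quad Tv)
    qed
    have coeff: "g i t = 0" if "t \<in> {1..m}" "i < t" for t
      using psd_combination_coeff_zero[OF P crit i(3) _ that, of "g i"] psd by (simp add: Z_def)
    have u: "(T *v u) $ a = 0" if "a \<notin> unreduced P (Suc i)" for a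
      using Suc.prems(2) that by (simp add: i_def)
    then have uQ: "\<forall>a. a \<notin> unreduced Q i \<longrightarrow> u $ a = 0"
      using unreduced_antimono[of i "Suc i" P] by (intro IH) auto
    \<comment> \<open>Only the first \<open>i\<close> matrices remain in \<open>Z\<close>, and all
      of them vanish on \<open>unreduced P (Suc i)\<close>, which contains the support of
      \<open>T *v u\<close>.\<close>
    have "(T *v u) \<bullet> (Z *v (T *v u)) = 0"
      unfolding inner_matrix_vector
    proof (intro sum.neutral ballI)
      fix a b
      have "Z $ a $ b = 0" if ab: "a \<in> unreduced P (Suc i)" "b \<in> unreduced P (Suc i)"
      proof -
        have "g i t * M t $ a $ b = 0" if t: "t \<in> {1..m}" for t
        proof (cases "t \<le> i")
          case True
          then have "b \<in> unreduced P t" using unreduced_antimono[of t "Suc i" P] ab by auto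
          then show ?thesis using regular_fr_seq_reduced_zero[OF P t, of "Suc i" a b] True ab by simp
        qed (use coeff[OF t] in auto)
        then have "(\<Sum>t=1..m. g i t * M t $ a $ b) = 0" by (intro sum.neutral) blast
        then show ?thesis by (simp add: Z_def)
      qed
      then show "Z $ a $ b * (T *v u) $ a * (T *v u) $ b = 0"
        using u[of a] u[of b] by auto
    qed
    then have "u $ a = 0" if "a \<in> Q i" for a
      using regular_fr_seq_quadratic_form_eq_0[OF Q i(1) uQ _ that] quad by simp
    then show ?case
      using uQ i(3) unfolding i_def[symmetric] by (auto simp: unreduced_Suc)
  qed
  have m: "m \<in> {1..m}" using k by simp
  \<comment> \<open>An index in the last block is untouched by the first \<open>k < m\<close>
    matrices, yet all \<open>m\<close> matrices together force feasible solutions to vanish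
    there.\<close>
  have "P m \<noteq> {}"
    using last P m unfolding last_block_nonempty_def by simp
  then obtain a where a: "a \<in> P m" by blast
  have aP: "a \<in> unreduced P (Suc k)"
    using regular_fr_seq_block_unreduced[OF P m, of "Suc k"] k a by auto
  obtain T' where T': "T ** T' = mat 1" using T unfolding invertible_def by blast
  define u where "u = T' *v axis a 1"
  have Tu: "T *v u = axis a 1" using T' by (simp add: u_def matrix_vector_mul_assoc)
  have uR: "u $ b = 0" if "b \<notin> last_indices r" for b
  proof -
    have "\<forall>c. c \<notin> unreduced P (Suc k) \<longrightarrow> (T *v u) $ c = 0"
      using aP by (auto simp: Tu axis_def)
    from faces[OF order_refl this] show ?thesis using that by (simp add: R)
  qed
  \<comment> \<open>The \<open>(a, a)\<close> entry of the transported solution is the form of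
    \<open>X\<close> at \<open>w\<close>. Its vanishing will kill \<open>w\<close> on
    \<open>last_indices r\<close>, while \<open>u\<close> vanishes off that set; this contradicts
    \<open>w \<bullet> u = 1\<close>.\<close>
  define w where "w = transpose T *v axis a 1"
  have wu: "w \<bullet> u = 1"
    using dot_lmul_matrix[of "axis a 1" T u] Tu by (simp add: w_def inner_axis_axis)
  have "T ** X ** transpose T \<in> reduced_cone m M"
    using feas[OF X(1)] d by (auto simp: feasible_def reduced_cone_def mat_perp_def psd_cone_def)
  then have "T ** X ** transpose T \<in> supported_on (unreduced P (Suc m))"
    by (simp add: reduced_cone_regular[OF P])
  moreover have "a \<notin> unreduced P (Suc m)" using a m by (auto simp: unreduced_def)
  ultimately have "(T ** X ** transpose T) $ a $ a = 0"
    unfolding supported_on_def by blast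
  moreover have "(T ** X ** transpose T) $ a $ a = w \<bullet> (X *v w)"
    using inner_congruence[of "axis a 1" "transpose T" X "axis a 1"]
    by (simp add: w_def inner_axis' matrix_vector_mult_basis column_def)
  ultimately have wX: "w \<bullet> (X *v w) = 0" by simp
  \<comment> \<open>Truncation leaves the form of \<open>X\<close> unchanged by its support, and
    makes \<open>w\<close> admissible for the definiteness of \<open>X\<close> on
    \<open>last_indices r\<close>.\<close>
  define w' where "w' = (\<chi> b. if b \<in> last_indices r then w $ b else 0)"
  have "w' \<bullet> (X *v w') = w \<bullet> (X *v w)"
    unfolding inner_matrix_vector using X(3)
    by (intro sum.cong[OF HOL.refl]) (auto simp: w'_def supported_on_def)
  then have "\<not> 0 < w' \<bullet> (X *v w')" using wX by simp
  moreover have "\<forall>b. b \<notin> last_indices r \<longrightarrow> w' $ b = 0" by (simp add: w'_def)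
  ultimately have "w' = 0" using X(2) unfolding pos_def_on_def by blast
  then have "w $ b = 0" if "b \<in> last_indices r" for b
  proof -
    have "w $ b = w' $ b" using that by (simp add: w'_def)
    then show ?thesis using \<open>w' = 0\<close> by simp
  qed
  then have "w $ b * u $ b = 0" for b
    using uR[of b] by (cases "b \<in> last_indices r") simp_all
  then have "w \<bullet> u = 0" unfolding inner_vec_def by (intro sum.neutral ballI) simp
  then show False using wu by simp
qed

section \<open>Shortening a certificate that has a zero critical block\<close>

text \<open>
  If the critical block of \<open>M\<^bsub>p+1\<^esub>\<close> vanishes, then \<open>c M\<^sub>p + M\<^bsub>p+1\<^esub>\<close> with \<open>c\<close> large is positive
  definite on \<open>P\<^sub>p \<union> P\<^bsub>p+1\<^esub>\<close> and replaces both matrices, after a congruence acting within these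
  indices has made the merged block diagonal.
\<close>

lemma certify_max_rank_merge:
  assumes cert: "certify_max_rank m M d m" and P: "regular_fr_seq m M P"
    and p: "1 \<le> p" "Suc p \<le> m"
    and block: "block_zero (M (Suc p)) (P p) (unreduced P (Suc (Suc p)))"
  shows "\<exists>M' d'. reformulation m M d M' d' \<and> certify_max_rank m M' d' (m - 1)"
proof -
  have p12: "p \<in> {1..m}" "Suc p \<in> {1..m}" using p by auto
  have d: "d i = 0" if "i \<in> {1..m}" for i
    using cert that unfolding certify_max_rank_def by blast
  obtain r X where r: "r \<le> CARD('a)" and cone: "reduced_cone m M = psd_cone \<inter> supported_on (last_indices r)"
    and X: "feasible m M d X" "X \<in> supported_on (last_indices r)" "pos_def_on (last_indices r) X"
    using cert unfolding certify_max_rank_def by blast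
  have R: "last_indices r = unreduced P (Suc m)"
    using regular_fr_seq_unreduced_eq[OF P cone] by simp
  define W where "W = P p \<union> P (Suc p)"
  have Wp: "W \<subseteq> unreduced P i" if "i \<le> p" for i
    using regular_fr_seq_block_unreduced[OF P, of _ i] p12 that by (auto simp: W_def)
  have Wq: "W \<inter> unreduced P i = {}" if "Suc p < i" for i
    using that p by (fastforce simp: W_def unreduced_def)
  have Pq: "P (Suc p) \<subseteq> unreduced P (Suc p)"
    using regular_fr_seq_block_unreduced[OF P p12(2)] by simp
  \<comment> \<open>Among vectors supported on \<open>W\<close>, the form of \<open>M p\<close>
    vanishes only on those supported on \<open>P (Suc p)\<close>, and there \<open>M (Suc p)\<close>
    is positive definite.\<close>
  obtain c where c: "0 < c" "pos_def_on W (c *\<^sub>R M p + M (Suc p))"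
  proof (rule pos_def_on_large_combination[of "M p" "M (Suc p)" W])
    show "M p \<in> sym_mats" "M (Suc p) \<in> sym_mats" using regular_fr_seq_sym[OF P] p12 by auto
    show "0 \<le> v \<bullet> (M p *v v)" if "\<forall>a. a \<notin> W \<longrightarrow> v $ a = 0" for v
      using that Wp[of p] by (intro regular_fr_seq_quadratic_form_nonneg[OF P p12(1)]) auto
    show "0 < v \<bullet> (M (Suc p) *v v)"
      if "v \<noteq> 0" and v: "\<forall>a. a \<notin> W \<longrightarrow> v $ a = 0" and zero: "v \<bullet> (M p *v v) = 0" for v
    proof -
      have "\<forall>a. a \<notin> unreduced P p \<longrightarrow> v $ a = 0" using v Wp[of p] by auto
      from regular_fr_seq_quadratic_form_eq_0[OF P p12(1) this zero]
      have v1: "\<forall>a. a \<notin> P (Suc p) \<longrightarrow> v $ a = 0" using v by (auto simp: W_def)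
      then have v2: "\<forall>a. a \<notin> unreduced P (Suc p) \<longrightarrow> v $ a = 0" using Pq by auto
      have "v \<bullet> (M (Suc p) *v v) \<noteq> 0"
        using regular_fr_seq_quadratic_form_eq_0[OF P p12(2) v2] v1 \<open>v \<noteq> 0\<close>
        by (metis vec_eq_iff zero_index)
      then show ?thesis using regular_fr_seq_quadratic_form_nonneg[OF P p12(2) v2] by simp
    qed
  qed
  define B where "B = c *\<^sub>R M p + M (Suc p)"
  have B_sym: "B \<in> sym_mats"
    unfolding B_def using regular_fr_seq_sym[OF P] p12
    by (intro sym_matsI) (simp add: sym_mats_nth[of "M p"] sym_mats_nth[of "M (Suc p)"])
  have B_pd: "pos_def_on W B" using c(2) by (simp add: B_def)
  have B_zero: "B $ a $ b = 0"
    if ab: "a \<in> unreduced P p" "b \<in> unreduced P p" "\<not> (a \<in> W \<and> b \<in> W)" for a b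
  proof -
    have "M p $ a $ b = 0"
      using ab by (intro regular_fr_seq_zero[OF P p12(1)]) (auto simp: W_def)
    moreover have "M (Suc p) $ a $ b = 0"
    proof (cases "a \<in> unreduced P (Suc p) \<and> b \<in> unreduced P (Suc p)")
      case True
      then show ?thesis
        using ab by (intro regular_fr_seq_zero[OF P p12(2)]) (auto simp: W_def)
    next
      case False
      \<comment> \<open>One of the two indices is in \<open>P p\<close>, so the other is outside
        \<open>W\<close> and the entry, up to symmetry, lies in the critical block. This is where
        its vanishing enters.\<close>
      then have "a \<in> P p \<and> b \<in> unreduced P (Suc (Suc p)) \<or> b \<in> P p \<and> a \<in> unreduced P (Suc (Suc p))"
        using ab p by (auto simp: unreduced_Suc W_def)
      then show ?thesis
        using block sym_mats_nth[OF regular_fr_seq_sym[OF P p12(2)], of a b]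
        unfolding block_zero_def by auto
    qed
    ultimately show ?thesis by (simp add: B_def)
  qed
  obtain T where T: "invertible T" "acts_within W T"
    and T_diag: "\<And>a b. a \<in> W \<Longrightarrow> b \<in> W \<Longrightarrow> a \<noteq> b \<Longrightarrow> (transpose T ** B ** T) $ a $ b = 0"
    using pos_def_on_diagonalize[OF B_sym B_pd] by blast

  \<comment> \<open>The coefficient at \<open>p\<close> is \<open>c > 0\<close>, so equation
    \<open>p\<close> may be replaced by the combination. Equation \<open>Suc p\<close> is then moved
    to position \<open>m\<close>, outside the shortened certificate.\<close>
  define y where "y t = (if t = p then c else if t = Suc p then 1 else 0)" for t
  define N where "N = move_last (Suc p) m (M(p := \<Sum>t=1..m. y t *\<^sub>R M t))"
  define d' where "d' = move_last (Suc p) m (d(p := \<Sum>t=1..m. y t * d t))"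
  define M' where "M' i = transpose T ** N i ** T" for i
  define Q where "Q i = (if i < p then P i else if i = p then W else P (Suc i))" for i
  have "reformulation m M d (M(p := \<Sum>t=1..m. y t *\<^sub>R M t)) (d(p := \<Sum>t=1..m. y t * d t))"
    using p12 c(1) by (intro reformulation.combine reformulation.refl) (auto simp: y_def)
  then have "reformulation m M d N d'"
    unfolding N_def d'_def using p by (intro reformulation_move_last) auto
  then have ref: "reformulation m M d M' d'"
    unfolding M'_def[abs_def] using T(1) by (rule reformulation.rotate)

  have "(\<Sum>t=1..m. y t *\<^sub>R M t) = (\<Sum>t=1..m. (if t = p then c *\<^sub>R M p else 0) + (if t = Suc p then M (Suc p) else 0))"
    by (intro sum.cong) (auto simp: y_def)
  also have "\<dots> = B" unfolding sum.distrib using p12 by (simp add: B_def)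
  finally have "(\<Sum>t=1..m. y t *\<^sub>R M t) = B" .
  then have N_nth: "N i = (if i = p then B else if i = m then M (Suc p) else if i < p \<or> m < i then M i else M (Suc i))" for i
    using p by (auto simp: N_def move_last_def)
  have N: "N i = M i" if "i < p" for i
    using that p by (simp add: N_nth)
  have Nq: "N i = M (Suc i)" if "Suc p \<le> i" "i < m" for i
    using that p by (simp add: N_nth)
  have Np: "N p = B" and Nm: "N m = M (Suc p)"
    using p by (simp_all add: N_nth)
  have unr: "unreduced Q i = unreduced P i" if "i \<le> p" for i
    using that by (auto simp: unreduced_def Q_def)
  have unr': "unreduced Q i = unreduced P (Suc i)" if "p < i" for i
  proof -
    have "(\<Union>j\<in>{1..<i}. Q j) = (\<Union>j\<in>{1..<Suc i}. P j)"
    proof (intro equalityI subsetI)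
      fix x assume "x \<in> (\<Union>j\<in>{1..<i}. Q j)"
      then obtain j where "j \<in> {1..<i}" "x \<in> Q j" by blast
      then have "x \<in> P j \<or> x \<in> P (Suc j)" by (auto simp: Q_def W_def split: if_splits)
      then show "x \<in> (\<Union>j\<in>{1..<Suc i}. P j)" using \<open>j \<in> {1..<i}\<close> by fastforce
    next
      fix x assume "x \<in> (\<Union>j\<in>{1..<Suc i}. P j)"
      then obtain j where j: "j \<in> {1..<Suc i}" "x \<in> P j" by blast
      consider "j < p" | "j = p \<or> j = Suc p" | "Suc p < j" by linarith
      then show "x \<in> (\<Union>j\<in>{1..<i}. Q j)"
      proof cases
        case 1
        then show ?thesis using j that by (intro UN_I[of j]) (auto simp: Q_def)
      next
        case 2
        then show ?thesis using j p that by (intro UN_I[of p]) (auto simp: Q_def W_def)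
      next
        case 3
        then show ?thesis using j by (intro UN_I[of "j - 1"]) (auto simp: Q_def)
      qed
    qed
    then show ?thesis by (simp add: unreduced_def)
  qed
  \<comment> \<open>All of \<open>W\<close> is still unreduced after step \<open>i\<close>, so every
    entry of \<open>M i\<close> that the congruence could mix within \<open>unreduced P i\<close> is
    zero.\<close>
  have M'_before: "M' i $ a $ b = M i $ a $ b"
    if i: "i \<in> {1..m}" "i < p" and ab: "a \<in> unreduced P i" "b \<in> unreduced P i" for i a b
  proof (cases "a \<in> W \<or> b \<in> W")
    case True
    have WS: "W \<subseteq> unreduced P (Suc i)" and Wi: "W \<subseteq> unreduced P i" using Wp i by auto
    have zero: "M i $ e $ f = 0"
      if "e \<in> unreduced P i" "f \<in> unreduced P i" "e \<in> W \<or> f \<in> W" for e f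
      using that WS i regular_fr_seq_zero[OF P i(1), of e f] by (auto simp: unreduced_Suc)
    have "M' i $ a $ b = 0"
      unfolding M'_def N[OF i(2)]
      by (rule congruence_zero[OF T(2)]) (use True ab Wi in \<open>auto intro!: zero\<close>)
    then show ?thesis using zero[OF ab True] by simp
  qed (auto simp: M'_def N[OF i(2)] congruence_outside[OF T(2)])
  have M'_p: "M' p $ a $ b = 0"
    if ab: "a \<in> unreduced P p" "b \<in> unreduced P p" "\<not> (a = b \<and> a \<in> W)" for a b
  proof (cases "a \<in> W \<and> b \<in> W")
    case True
    then show ?thesis using T_diag ab by (simp add: M'_def Np)
  next
    case False
    then show ?thesis unfolding M'_def Np
      by (intro congruence_zero[OF T(2)] B_zero) (use ab Wp[of p] in auto)
  qed
  \<comment> \<open>The constrained indices of a later matrix avoid \<open>W\<close>, where alone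
    the congruence acts.\<close>
  have M'_after: "M' i $ a $ b = M (Suc i) $ a $ b"
    if "p < i" "i < m" "a \<in> unreduced P (Suc i)" "b \<in> unreduced P (Suc i)" for i a b
    using that Wq[of "Suc i"] unfolding M'_def Nq[OF Suc_leI[OF that(1)] that(2)]
    by (intro congruence_outside[OF T(2)]) auto
  have reg: "regular_fr_seq (m - 1) M' Q"
  proof (rule regular_fr_seqI)
    fix i assume i: "i \<in> {1..m - 1}"
    then have i': "i \<in> {1..m}" "i < m" "p < i \<Longrightarrow> Suc i \<in> {1..m}" using p by auto
    have cases: "i < p \<or> i = p \<or> p < i" by auto
    have "N i \<in> sym_mats"
      using cases i' regular_fr_seq_sym[OF P] B_sym by (auto simp: N Np Nq Suc_le_eq)
    then show "M' i \<in> sym_mats" unfolding M'_def by (rule sym_mats_congruence)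
    show "0 < M' i $ a $ a" if a: "a \<in> Q i" for a
      using cases
    proof (elim disjE)
      assume "i < p"
      then show ?thesis
        using a i' regular_fr_seq_diag_pos[OF P i'(1), of a] regular_fr_seq_block_unreduced[OF P i'(1) order_refl]
        by (auto simp: Q_def M'_before)
    next
      assume "i = p"
      then show ?thesis
        using a pos_def_on_diag[OF pos_def_on_congruence[OF B_sym B_pd T], of a]
        by (simp add: Q_def M'_def Np)
    next
      assume "p < i"
      then show ?thesis
        using a i' regular_fr_seq_diag_pos[OF P i'(3), of a] regular_fr_seq_block_unreduced[OF P i'(3) order_refl]
        by (auto simp: Q_def M'_after)
    qed
    show "M' i $ a $ b = 0"
      if ab: "a \<in> unreduced Q i" "b \<in> unreduced Q i" "\<not> (a = b \<and> a \<in> Q i)" for a b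
      using cases
    proof (elim disjE)
      assume "i < p"
      then show ?thesis
        using ab regular_fr_seq_zero[OF P i'(1), of a b] i' by (simp add: unr M'_before Q_def)
    next
      assume "i = p"
      then show ?thesis using ab M'_p[of a b] by (simp add: unr Q_def)
    next
      assume "p < i"
      then show ?thesis
        using ab regular_fr_seq_zero[OF P i'(3), of a b] i' by (simp add: unr' M'_after Q_def)
    qed
    show "Q i \<subseteq> unreduced Q i"
      using cases
    proof (elim disjE)
      assume "i < p"
      then show ?thesis
        using regular_fr_seq_block_unreduced[OF P i'(1) order_refl] by (simp add: unr Q_def)
    next
      assume "i = p"
      then show ?thesis using Wp[of p] by (simp add: unr Q_def)
    next
      assume "p < i"
      then show ?thesis
        using regular_fr_seq_block_unreduced[OF P i'(3) order_refl] by (simp add: unr' Q_def)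
    qed
  qed
  have "reduced_cone (m - 1) M' = psd_cone \<inter> supported_on (last_indices r)"
    using reduced_cone_regular[OF reg] unr'[of m] p R by simp
  moreover have "\<forall>i\<in>{1..m - 1}. d' i = 0" and "feasible m M' d' X"
  proof -
    have "(\<Sum>t=1..m. y t * d t) = 0" using d by (intro sum.neutral) simp
    then have d': "d' i = 0" if "i \<in> {1..m}" for i
      using that d p by (auto simp: d'_def move_last_def)
    then show "\<forall>i\<in>{1..m - 1}. d' i = 0" by auto
    have MX: "mat_inner (M i) X = 0" if "i \<in> {1..m}" for i
      using X(1) that d by (simp add: feasible_def)
    have BX: "mat_inner B X = 0"
      using MX p12 by (simp add: B_def mat_inner_sum distrib_right sum.distrib mult.assoc flip: sum_distrib_left)
    have NX: "mat_inner (N i) X = 0" if "i \<in> {1..m}" for i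
    proof -
      have "i \<le> m" using that by simp
      then consider "i < p" | "i = p" | "Suc p \<le> i" "i < m" | "i = m" by linarith
      then show ?thesis
        by cases (use that p in \<open>simp_all add: N Np Nq Nm MX BX\<close>)
    qed
    \<comment> \<open>The solution is supported on \<open>last_indices r\<close>, which is disjoint
      from the merged blocks.\<close>
    have "T ** X ** transpose T = X"
      using Wq[of "Suc m"] p X(2) by (intro congruence_supported_outside[OF T(2)]) (auto simp: R)
    then show "feasible m M' d' X"
      using X(1) NX d' by (simp add: feasible_def M'_def mat_inner_congruence)
  qed
  ultimately have "certify_max_rank m M' d' (m - 1)"
    unfolding certify_max_rank_def using r reg X(2,3) by (intro conjI) (auto intro!: exI[of _ r])
  then show ?thesis using ref by blast
qed

section \<open>From reformulations to the singularity degree\<close>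

lemma singularity_degree_le:
  "reformulation m M d M' d' \<Longrightarrow> certify_max_rank m M' d' k \<Longrightarrow> singularity_degree m M d \<le> k"
  unfolding singularity_degree_def by (rule Least_le) blast

theorem theorem4:
  fixes m :: nat
    and M :: "nat \<Rightarrow> real^'n::{finite,linorder}^'n::{finite,linorder}"
    and d :: "nat \<Rightarrow> real"
  assumes sym: "\<forall>i\<in>{1..m}. M i \<in> sym_mats"
    and rr: "rr_form m M d"
  shows "(singularity_degree m M d = m \<longrightarrow>
            (certify_max_rank m M d m \<and> (\<forall>i\<in>{1..m}. d i = 0)) \<and>
            critical_blocks_nonzero m M) \<and>
         (last_block_nonempty m M \<longrightarrow>
            (singularity_degree m M d = m \<longleftrightarrow>
               (certify_max_rank m M d m \<and> (\<forall>i\<in>{1..m}. d i = 0)) \<and>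
               critical_blocks_nonzero m M))"
proof -
  have necessary: "certify_max_rank m M d m \<and> (\<forall>i\<in>{1..m}. d i = 0) \<and> critical_blocks_nonzero m M"
    if deg: "singularity_degree m M d = m"
  proof -
    obtain k where k: "certify_max_rank m M d k" using rr unfolding rr_form_def by blast
    \<comment> \<open>The system is a reformulation of itself, so its degree \<open>m\<close> is at
      most the certifying number \<open>k\<close>, which in turn is at most
      \<open>m\<close>.\<close>
    then have "k \<le> m" "m \<le> k"
      using singularity_degree_le[OF reformulation.refl k] deg by (auto simp: certify_max_rank_def)
    then have cert: "certify_max_rank m M d m" using k by simp
    then obtain P where P: "regular_fr_seq m M P" and d: "\<forall>i\<in>{1..m}. d i = 0"
      unfolding certify_max_rank_def by blast
    have "\<not> block_zero (M i) (P (i - 1)) (\<Union>j\<in>{i+1..m+1}. ext_structure m P j)" if i: "i \<in> {2..m}" for i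
    proof
      assume "block_zero (M i) (P (i - 1)) (\<Union>j\<in>{i+1..m+1}. ext_structure m P j)"
      then have block: "block_zero (M (Suc (i - 1))) (P (i - 1)) (unreduced P (Suc (Suc (i - 1))))"
        using i ext_structure_UN[OF P, of i] by simp
      have "1 \<le> i - 1" "Suc (i - 1) \<le> m" using i by auto
      from certify_max_rank_merge[OF cert P this block] obtain M' d'
        where "reformulation m M d M' d'" "certify_max_rank m M' d' (m - 1)" by blast
      then have "singularity_degree m M d \<le> m - 1" by (rule singularity_degree_le)
      then show False using deg i by simp
    qed
    then show ?thesis using cert d P unfolding critical_blocks_nonzero_def by blast
  qed
  have sufficient: "singularity_degree m M d = m"
    if "last_block_nonempty m M" "certify_max_rank m M d m" "critical_blocks_nonzero m M"
  proof (rule antisym)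
    show "singularity_degree m M d \<le> m"
      using singularity_degree_le[OF reformulation.refl that(2)] .
    \<comment> \<open>The minimum is attained, because the system itself provides a candidate with
      value \<open>m\<close>.\<close>
    have "\<exists>M' d'. reformulation m M d M' d' \<and> certify_max_rank m M' d' (singularity_degree m M d)"
      unfolding singularity_degree_def
      by (rule LeastI[where k = m]) (use that(2) reformulation.refl in blast)
    then show "m \<le> singularity_degree m M d"
      using certify_max_rank_minimal[OF that(2,3,1)] by blast
  qed
  show ?thesis using necessary sufficient by blast
qed

end
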